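(* The variety of complex $3$-dimensional associative superalgebras of type $(2,1)$ has dimension $5$ and has exactly $13$ irreducible components, namely $\overline{\mathcal{O}(\mathbf{R}_{k})}$ for $k\in\{01,03,04,05,07,23,25,26,29,31,32,33,36\}$. In particular, exactly $13$ superalgebras are rigid in this variety.
   Context: All algebras are over $\mathbb{C}$. A superalgebra is a $\mathbb{Z}_2$-graded algebra $A=A_0\oplus A_1$ with $A_iA_j\subseteq A_{i+j \bmod 2}$; $|x|\in\{0,1\}$ is the degree of a homogeneous $x$. It has type $(n,m)$ if $\dim A_0=n$, $\dim A_1=m$. The associator is $(x,y,z)=(xy)z-x(yz)$; a superalgebra is associative if $(x,y,z)=0$ for all $x,y,z$. Geometric setting: fix a graded space $V=V_0\oplus V_1$ of type $(n,m)$ with a homogeneous basis. Superalgebra structures on $V$ are even bilinear maps $\mu:V\times V\to V$, identified with their structure constants; those satisfying a given family of graded polynomial identities form a Zariski-closed subset (an affine variety) of this affine space. The group $GL(V_0)\times GL(V_1)$ acts by $(g*\mu)(x,y)=g\mu(g^{-1}x,g^{-1}y)$; its orbits are the isomorphism classes. $\mathcal{O}(A)$ denotes the orbit of (a structure representing) $A$ and $\overline{\mathcal{O}(A)}$ its Zariski closure. A superalgebra is rigid if its orbit is open in the variety. The dimension of the variety is the maximal dimension of its irreducible components. Superalgebras of type $(2,1)$, in basis $e_1,e_2$ (even), $f_1$ (odd), listed by nonzero products (unlisted products are zero): $\mathbf{R}_{01}$: $e_1e_1=e_1,\ e_2e_2=e_2$; $\mathbf{R}_{03}$: $e_1e_1=e_1,\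 e_2e_2=e_2,\ e_1f_1=f_1,\ f_1e_1=f_1,\ f_1f_1=e_1$; $\mathbf{R}_{04}$: $e_1e_1=e_1,\ e_2e_2=e_2,\ f_1e_1=f_1$; $\mathbf{R}_{05}$: $e_1e_1=e_1,\ e_2e_2=e_2,\ e_1f_1=f_1$; $\mathbf{R}_{07}$: $e_1e_1=e_1,\ e_2e_2=e_2,\ e_2f_1=f_1,\ f_1e_1=f_1$; $\mathbf{R}_{23}$: $e_1e_1=e_1,\ e_1e_2=e_2$; $\mathbf{R}_{25}$: $e_1e_1=e_1,\ e_2e_1=e_2$; $\mathbf{R}_{26}$: $e_1e_1=e_1,\ e_2e_1=e_2,\ e_1f_1=f_1$; $\mathbf{R}_{29}$: $e_1e_1=e_1,\ e_1e_2=e_2,\ f_1e_1=f_1$; $\mathbf{R}_{31}$: $e_1e_1=e_1,\ e_2e_1=e_2,\ f_1e_1=f_1$; $\mathbf{R}_{32}$: $e_1e_1=e_1,\ e_1e_2=e_2,\ e_1f_1=f_1$; $\mathbf{R}_{33}$: $e_1e_1=e_1,\ e_2e_1=e_2,\ e_1f_1=f_1,\ f_1e_1=f_1$; $\mathbf{R}_{36}$: $e_1e_1=e_1,\ e_1e_2=e_2,\ e_1f_1=f_1,\ f_1e_1=f_1$. *)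

theory Defs
  imports "HOL-Analysis.Analysis" "HOL-Library.Extended_Nat"
begin

datatype idx = E1 | E2 | F1

lemma UNIV_idx: "(UNIV :: idx set) = {E1, E2, F1}"
  using idx.exhaust by auto

instance idx :: finite
  by standard (simp add: UNIV_idx)

fun par :: "idx \<Rightarrow> nat" where
  "par E1 = 0" | "par E2 = 0" | "par F1 = 1"

text \<open>A structure (bilinear map on V) is given by structure constants
  c (i,j,k) = coefficient of basis vector k in the product b_i b_j.\<close>

type_synonym struc = "idx \<times> idx \<times> idx \<Rightarrow> complex"

definition mult :: "struc \<Rightarrow> (idx \<Rightarrow> complex) \<Rightarrow> (idx \<Rightarrow> complex) \<Rightarrow> (idx \<Rightarrow> complex)" where
  "mult c x y = (\<lambda>k. \<Sum>i\<in>UNIV. \<Sum>j\<in>UNIV. x i * y j * c (i, j, k))"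

definition even_struc :: "struc \<Rightarrow> bool" where
  "even_struc c \<longleftrightarrow> (\<forall>i j k. par k \<noteq> (par i + par j) mod 2 \<longrightarrow> c (i, j, k) = 0)"

definition assoc_struc :: "struc \<Rightarrow> bool" where
  "assoc_struc c \<longleftrightarrow> (\<forall>x y z. mult c (mult c x y) z = mult c x (mult c y z))"

definition AssocVar :: "struc set" where
  "AssocVar = {c. even_struc c \<and> assoc_struc c}"

definition app :: "(idx \<Rightarrow> idx \<Rightarrow> complex) \<Rightarrow> (idx \<Rightarrow> complex) \<Rightarrow> (idx \<Rightarrow> complex)" where
  "app g v = (\<lambda>i. \<Sum>j\<in>UNIV. g i j * v j)"

definition gl_even :: "(idx \<Rightarrow> idx \<Rightarrow> complex) \<Rightarrow> bool" where
  "gl_even g \<longleftrightarrow> (\<forall>i j. par i \<noteq> par j \<longrightarrow> g i j = 0) \<and>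
     (\<exists>h. (\<forall>v. app h (app g v) = v) \<and> (\<forall>v. app g (app h v) = v))"

definition orbit :: "struc \<Rightarrow> struc set" where
  "orbit c = {c'. \<exists>g. gl_even g \<and> (\<forall>x y. mult c' (app g x) (app g y) = app g (mult c x y))}"

inductive_set polyfun :: "(('v \<Rightarrow> complex) \<Rightarrow> complex) set" where
  pconst: "(\<lambda>p. a) \<in> polyfun"
| pvar: "(\<lambda>p. p v) \<in> polyfun"
| padd: "f \<in> polyfun \<Longrightarrow> g \<in> polyfun \<Longrightarrow> (\<lambda>p. f p + g p) \<in> polyfun"
| pmult: "f \<in> polyfun \<Longrightarrow> g \<in> polyfun \<Longrightarrow> (\<lambda>p. f p * g p) \<in> polyfun"

definition zariski :: "('v \<Rightarrow> complex) topology" where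
  "zariski = topology (\<lambda>U. \<exists>F \<subseteq> polyfun. U = - {p. \<forall>f\<in>F. f p = 0})"

definition XT :: "struc topology" where
  "XT = subtopology zariski AssocVar"

definition irreducible_in :: "'a topology \<Rightarrow> 'a set \<Rightarrow> bool" where
  "irreducible_in T S \<longleftrightarrow> S \<subseteq> topspace T \<and> S \<noteq> {} \<and>
     (\<forall>A B. closedin T A \<longrightarrow> closedin T B \<longrightarrow> S \<subseteq> A \<union> B \<longrightarrow> S \<subseteq> A \<or> S \<subseteq> B)"

definition irr_component :: "'a topology \<Rightarrow> 'a set \<Rightarrow> bool" where
  "irr_component T S \<longleftrightarrow> irreducible_in T S \<and>
     (\<forall>S'. irreducible_in T S' \<longrightarrow> S \<subseteq> S' \<longrightarrow> S' = S)"

definition chain_len :: "'a topology \<Rightarrow> nat \<Rightarrow> bool" where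
  "chain_len T n \<longleftrightarrow> (\<exists>Z :: nat \<Rightarrow> 'a set.
      (\<forall>i\<le>n. closedin T (Z i) \<and> irreducible_in T (Z i)) \<and> (\<forall>i<n. Z i \<subset> Z (Suc i)))"

definition krull_dim :: "'a topology \<Rightarrow> enat" where
  "krull_dim T = Sup {enat n | n. chain_len T n}"

definition variety_dim :: "'a topology \<Rightarrow> enat" where
  "variety_dim T = Sup {krull_dim (subtopology T C) | C. irr_component T C}"

definition rigid :: "struc \<Rightarrow> bool" where
  "rigid c \<longleftrightarrow> c \<in> AssocVar \<and> openin XT (orbit c)"

definition sc :: "(idx \<times> idx \<times> idx) list \<Rightarrow> struc" where
  "sc L = (\<lambda>t. if t \<in> set L then 1 else 0)"

definition "R01 = sc [(E1,E1,E1), (E2,E2,E2)]"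
definition "R03 = sc [(E1,E1,E1), (E2,E2,E2), (E1,F1,F1), (F1,E1,F1), (F1,F1,E1)]"
definition "R04 = sc [(E1,E1,E1), (E2,E2,E2), (F1,E1,F1)]"
definition "R05 = sc [(E1,E1,E1), (E2,E2,E2), (E1,F1,F1)]"
definition "R07 = sc [(E1,E1,E1), (E2,E2,E2), (E2,F1,F1), (F1,E1,F1)]"
definition "R23 = sc [(E1,E1,E1), (E1,E2,E2)]"
definition "R25 = sc [(E1,E1,E1), (E2,E1,E2)]"
definition "R26 = sc [(E1,E1,E1), (E2,E1,E2), (E1,F1,F1)]"
definition "R29 = sc [(E1,E1,E1), (E1,E2,E2), (F1,E1,F1)]"
definition "R31 = sc [(E1,E1,E1), (E2,E1,E2), (F1,E1,F1)]"
definition "R32 = sc [(E1,E1,E1), (E1,E2,E2), (E1,F1,F1)]"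
definition "R33 = sc [(E1,E1,E1), (E2,E1,E2), (E1,F1,F1), (F1,E1,F1)]"
definition "R36 = sc [(E1,E1,E1), (E1,E2,E2), (E1,F1,F1), (F1,E1,F1)]"

definition Rlist :: "struc set" where
  "Rlist = {R01, R03, R04, R05, R07, R23, R25, R26, R29, R31, R32, R33, R36}"

end

theory Submission
  imports Defs "HOL-Computational_Algebra.Polynomial"
begin

text \<open>An even structure with associative product is, up to isomorphism, of one of two kinds. If some
  even \<open>x\<close> is linearly independent of \<open>x x\<close>, the even part is a degeneration of \<open>\<complex> \<times> \<complex>\<close> inside a
  polynomial family with parameters; the generic members of the family form the orbits of
  \<open>R\<^sub>0\<^sub>1, R\<^sub>0\<^sub>3, R\<^sub>0\<^sub>4, R\<^sub>0\<^sub>5, R\<^sub>0\<^sub>7\<close>, so all members lie in their closures. Otherwise the even part has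
  product \<open>x y = \<phi>(x) y\<close> or \<open>x y = \<phi>(y) x\<close>, and the action on the odd part is by \<open>0\<close> or \<open>\<phi>\<close> on
  either side; this gives the remaining eight orbits, and for \<open>\<phi> = 0\<close> a degeneration of \<open>R\<^sub>0\<^sub>3\<close>.
  Each of the 13 orbits is cut out of the variety by the nonvanishing of one polynomial near a
  suitable representative, hence open; orbits are irreducible as rational images of the group, so
  their closures are the components. For the dimension, a chain of \<open>n + 1\<close> irreducible closed sets
  yields \<open>n\<close> algebraically independent functions on its top, while by counting monomials more than
  5 functions on the rational image of a 5-dimensional space are dependent; turning on the five
  parameters of the family for \<open>R\<^sub>0\<^sub>3\<close> one after the other gives a chain of length 5.\<close>

section \<open>The Zariski topology\<close>

text \<open>The number 5 is the dimension of GL_2 x GL_1: every orbit is parametrized by the five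
  entries of an even matrix, and the stabilizer of \<open>R03\<close> is finite. As dimension is
  defined by chains of closed sets, this count has to be turned into statements about chains, in
  both directions. The obstacle in the classification is the degenerate structures, for instance
  those with nilpotent even part, which contain no idempotents to start from. They are not listed up
  to isomorphism but recognized as special values of a polynomial family. Its parameters are two
  roots \<open>a\<close> and \<open>b\<close> rather than their symmetric functions, because a
  character acting on the odd part selects one of the roots and is not polynomial in the
  coefficients. Linear independence of \<open>x\<close> and \<open>x x\<close> is used, after a
  change of basis, as \<open>c (E1, E1, E2) \<noteq> 0\<close>: then e_1 and its square span the
  even part.\<close>

lemma polyfun_uminus: "f \<in> polyfun \<Longrightarrow> (\<lambda>p. - f p) \<in> polyfun"
  using pmult[OF pconst[of "-1"], of f] by simp

lemma polyfun_diff: "f \<in> polyfun \<Longrightarrow> g \<in> polyfun \<Longrightarrow> (\<lambda>p. f p - g p) \<in> polyfun"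
  using padd[OF _ polyfun_uminus, of f g] by simp

lemma polyfun_power: "f \<in> polyfun \<Longrightarrow> (\<lambda>p. f p ^ n) \<in> polyfun"
  by (induction n) (auto intro: pconst pmult)

lemma polyfun_sum: "(\<And>i. i \<in> I \<Longrightarrow> f i \<in> polyfun) \<Longrightarrow> (\<lambda>p. \<Sum>i\<in>I. f i p) \<in> polyfun"
  by (induction I rule: infinite_finite_induct) (auto intro: pconst padd)

lemmas polyfun_intros = pconst pvar padd pmult polyfun_uminus polyfun_diff polyfun_power polyfun_sum

lemma polyfun_compose:
  assumes "f \<in> polyfun" "\<And>v. (\<lambda>p. \<phi> p v) \<in> polyfun"
  shows "(\<lambda>p. f (\<phi> p)) \<in> polyfun"
  using assms(1) by induction (auto intro: polyfun_intros assms(2))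

definition zariski_closed :: "('v \<Rightarrow> complex) set \<Rightarrow> bool" where
  "zariski_closed S \<longleftrightarrow> (\<exists>F \<subseteq> polyfun. S = {p. \<forall>f\<in>F. f p = 0})"

lemma zariski_closed_Un:
  assumes "zariski_closed S" "zariski_closed T"
  shows "zariski_closed (S \<union> T)"
proof -
  obtain F G where F: "F \<subseteq> polyfun" "S = {p. \<forall>f\<in>F. f p = 0}"
    and G: "G \<subseteq> polyfun" "T = {p. \<forall>f\<in>G. f p = 0}"
    using assms unfolding zariski_closed_def by blast
  have "S \<union> T = {p. \<forall>h\<in>{\<lambda>p. f p * g p | f g. f \<in> F \<and> g \<in> G}. h p = 0}"
    unfolding F(2) G(2) by (auto; metis mult_eq_0_iff)
  moreover have "{\<lambda>p. f p * g p | f g. f \<in> F \<and> g \<in> G} \<subseteq> polyfun"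
    using F(1) G(1) by (auto intro: pmult)
  ultimately show ?thesis
    unfolding zariski_closed_def by blast
qed

lemma zariski_closed_Inter:
  assumes "\<And>K. K \<in> \<K> \<Longrightarrow> zariski_closed K"
  shows "zariski_closed (\<Inter>\<K>)"
proof -
  define F where "F = {f \<in> polyfun. \<exists>K\<in>\<K>. \<forall>p\<in>K. f p = 0}"
  have "p \<in> \<Inter>\<K>" if p: "\<forall>f\<in>F. f p = 0" for p
  proof (rule InterI)
    fix K assume K: "K \<in> \<K>"
    obtain G where G: "G \<subseteq> polyfun" "K = {p. \<forall>f\<in>G. f p = 0}"
      using assms[OF K] unfolding zariski_closed_def by auto
    have "G \<subseteq> F"
      unfolding F_def using G by (auto intro!: bexI[OF _ K])
    then show "p \<in> K" using p G(2) by auto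
  qed
  moreover have "f p = 0" if "p \<in> \<Inter>\<K>" "f \<in> F" for p f
    using that unfolding F_def by auto
  ultimately have "\<Inter>\<K> = {p. \<forall>f\<in>F. f p = 0}"
    by (intro equalityI subsetI CollectI) auto
  moreover have "F \<subseteq> polyfun"
    unfolding F_def by simp
  ultimately show ?thesis
    unfolding zariski_closed_def by (intro exI conjI)
qed

lemma openin_zariski:
  fixes U :: "('v \<Rightarrow> complex) set"
  shows "openin zariski U \<longleftrightarrow> zariski_closed (- U)"
proof -
  have eq: "(\<exists>F \<subseteq> polyfun. U = - {p. \<forall>f\<in>F. f p = 0}) \<longleftrightarrow> zariski_closed (- U)"
    for U :: "('v \<Rightarrow> complex) set"
  proof -
    have "U = - X \<longleftrightarrow> - U = X" for X by blast
    then show ?thesis unfolding zariski_closed_def by simp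
  qed
  have "istopology (\<lambda>U :: ('v \<Rightarrow> complex) set. zariski_closed (- U))"
    unfolding istopology_def
  proof (intro conjI allI impI)
    fix \<K> :: "('v \<Rightarrow> complex) set set"
    assume "\<forall>K\<in>\<K>. zariski_closed (- K)"
    then have "zariski_closed (\<Inter> (uminus ` \<K>))"
      by (intro zariski_closed_Inter) auto
    also have "\<Inter> (uminus ` \<K>) = - \<Union>\<K>"
      by auto
    finally show "zariski_closed (- \<Union>\<K>)" .
  qed (simp add: zariski_closed_Un)
  then show ?thesis
    unfolding zariski_def eq by (simp add: topology_inverse')
qed

lemma topspace_zariski [simp]: "topspace (zariski :: ('v \<Rightarrow> complex) topology) = UNIV"
proof -
  have "openin zariski (UNIV :: ('v \<Rightarrow> complex) set)"
    unfolding openin_zariski zariski_closed_def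
    by (rule exI[of _ "{\<lambda>p. 1}"]) (auto intro: pconst)
  then show ?thesis
    using openin_subset by blast
qed

lemma closedin_zariski: "closedin zariski S \<longleftrightarrow> zariski_closed S"
  by (simp add: closedin_def openin_zariski Compl_eq_Diff_UNIV [symmetric])

lemma zariski_closed_zeros: "f \<in> polyfun \<Longrightarrow> zariski_closed {p. f p = 0}"
  unfolding zariski_closed_def by (rule exI[of _ "{f}"]) auto

lemma zariski_closed_separate:
  assumes "zariski_closed S" "p \<notin> S"
  obtains f where "f \<in> polyfun" "\<And>s. s \<in> S \<Longrightarrow> f s = 0" "f p \<noteq> 0"
  using assms unfolding zariski_closed_def by blast

lemma polyfun_on_line:
  assumes "f \<in> polyfun"
  shows "\<exists>P :: complex poly. \<forall>t. f (\<lambda>v. p v + t * (q v - p v)) = poly P t"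
  using assms
proof induction
  case (pconst a)
  then show ?case by (intro exI[of _ "[:a:]"]) simp
next
  case (pvar v)
  then show ?case by (intro exI[of _ "[:p v, q v - p v:]"]) simp
next
  case (padd f g)
  then show ?case by (metis poly_add)
next
  case (pmult f g)
  then show ?case by (metis poly_mult)
qed

text \<open>Polynomial functions have no zero divisors: on the line joining \<open>p\<close> to
  \<open>q\<close> both factors are univariate polynomials, the first is nonzero at
  \<open>t = 0\<close>, and the second is evaluated at \<open>t = 1\<close>.\<close>

lemma polyfun_mult_eq_0:
  assumes "f \<in> polyfun" "g \<in> polyfun" "\<And>p. f p * g p = 0" "f p \<noteq> 0"
  shows "g q = 0"
proof -
  obtain P where P: "\<And>t. f (\<lambda>v. p v + t * (q v - p v)) = poly P t"
    using polyfun_on_line[OF assms(1)] by meson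
  obtain Q where Q: "\<And>t. g (\<lambda>v. p v + t * (q v - p v)) = poly Q t"
    using polyfun_on_line[OF assms(2)] by meson
  have "poly (P * Q) t = 0" for t
    by (simp flip: P Q add: assms(3)[simplified])
  then have "P * Q = 0"
    using poly_all_0_iff_0 by blast
  moreover have "poly P 0 \<noteq> 0"
    using assms(4) by (simp flip: P)
  ultimately have "Q = 0" by auto
  then show ?thesis using Q[of 1] by simp
qed

text \<open>The set where \<open>D\<close> is nonzero is dense, so a closed condition that holds for
  generic parameters holds for all. Degenerate structures enter orbit closures in this way.\<close>

lemma zariski_closed_contains_image:
  assumes "zariski_closed K" "\<And>v. (\<lambda>p. \<phi> p v) \<in> polyfun" "D \<in> polyfun" "D p\<^sub>0 \<noteq> 0"
    and "\<And>p. D p \<noteq> 0 \<Longrightarrow> \<phi> p \<in> K"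
  shows "\<phi> p \<in> K"
proof (rule ccontr)
  assume "\<phi> p \<notin> K"
  then obtain f where f: "f \<in> polyfun" "\<And>s. s \<in> K \<Longrightarrow> f s = 0" "f (\<phi> p) \<noteq> 0"
    using zariski_closed_separate[OF assms(1)] by blast
  have "(\<lambda>p. f (\<phi> p)) \<in> polyfun"
    using polyfun_compose[OF f(1)] assms(2) by blast
  moreover have "D p * f (\<phi> p) = 0" for p
    using f(2) assms(5) by auto
  ultimately have "f (\<phi> p) = 0"
    using polyfun_mult_eq_0[where f = D and g = "\<lambda>p. f (\<phi> p)"] assms(3,4) by blast
  with f(3) show False by simp
qed

text \<open>\<open>D\<close> plays the role of a common denominator of the coordinates of \<open>\<phi>\<close>.\<close>

definition rational_map :: "(('p \<Rightarrow> complex) \<Rightarrow> complex) \<Rightarrow> (('p \<Rightarrow> complex) \<Rightarrow> 'v \<Rightarrow> complex) \<Rightarrow> bool" where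
  "rational_map D \<phi> \<longleftrightarrow> D \<in> polyfun \<and>
     (\<forall>v. \<exists>k. \<exists>h\<in>polyfun. \<forall>p. D p \<noteq> 0 \<longrightarrow> D p ^ k * \<phi> p v = h p)"

lemma rational_map_compose:
  assumes "rational_map D \<phi>" "f \<in> polyfun"
  shows "\<exists>k. \<exists>h\<in>polyfun. \<forall>p. D p \<noteq> 0 \<longrightarrow> D p ^ k * f (\<phi> p) = h p"
  using assms(2)
proof induction
  case (pconst a)
  show ?case by (rule exI[of _ 0]) (auto intro: polyfun.pconst)
next
  case (pvar v)
  then show ?case using assms(1) unfolding rational_map_def by blast
next
  case (padd f g)
  then obtain k h k' h' where h: "h \<in> polyfun" "\<And>p. D p \<noteq> 0 \<Longrightarrow> D p ^ k * f (\<phi> p) = h p"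
    "h' \<in> polyfun" "\<And>p. D p \<noteq> 0 \<Longrightarrow> D p ^ k' * g (\<phi> p) = h' p" by blast
  show ?case
  proof (intro exI bexI allI impI)
    fix p assume p: "D p \<noteq> 0"
    show "D p ^ (k + k') * (f (\<phi> p) + g (\<phi> p)) = h p * D p ^ k' + h' p * D p ^ k"
      by (simp flip: h(2)[OF p] h(4)[OF p] add: algebra_simps power_add)
  next
    show "(\<lambda>p. h p * D p ^ k' + h' p * D p ^ k) \<in> polyfun"
      using h assms(1) unfolding rational_map_def by (intro polyfun_intros) auto
  qed
next
  case (pmult f g)
  then obtain k h k' h' where h: "h \<in> polyfun" "\<And>p. D p \<noteq> 0 \<Longrightarrow> D p ^ k * f (\<phi> p) = h p"
    "h' \<in> polyfun" "\<And>p. D p \<noteq> 0 \<Longrightarrow> D p ^ k' * g (\<phi> p) = h' p" by blast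
  show ?case
  proof (intro exI bexI allI impI)
    fix p assume p: "D p \<noteq> 0"
    show "D p ^ (k + k') * (f (\<phi> p) * g (\<phi> p)) = h p * h' p"
      by (simp flip: h(2)[OF p] h(4)[OF p] add: algebra_simps power_add)
  next
    show "(\<lambda>p. h p * h' p) \<in> polyfun"
      using h by (intro polyfun_intros) auto
  qed
qed

lemma polynomial_rational_map:
  assumes "\<And>v. (\<lambda>p. \<phi> p v) \<in> polyfun"
  shows "rational_map (\<lambda>p. 1) \<phi>"
  unfolding rational_map_def using assms by (auto intro: pconst)

section \<open>Irreducible sets\<close>

lemma irreducible_in_subtopology:
  "irreducible_in (subtopology T Y) S \<longleftrightarrow> S \<subseteq> Y \<and> irreducible_in T S"
proof (intro iffI conjI)
  assume L: "irreducible_in (subtopology T Y) S"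
  then show Y: "S \<subseteq> Y" unfolding irreducible_in_def by auto
  show "irreducible_in T S"
    unfolding irreducible_in_def
  proof (intro conjI allI impI)
    show "S \<subseteq> topspace T" "S \<noteq> {}"
      using L unfolding irreducible_in_def by auto
    fix A B assume "closedin T A" "closedin T B" "S \<subseteq> A \<union> B"
    then have "closedin (subtopology T Y) (A \<inter> Y)" "closedin (subtopology T Y) (B \<inter> Y)"
       "S \<subseteq> (A \<inter> Y) \<union> (B \<inter> Y)"
      using Y by (auto simp: closedin_subtopology)
    then have "S \<subseteq> A \<inter> Y \<or> S \<subseteq> B \<inter> Y"
      using L unfolding irreducible_in_def by blast
    then show "S \<subseteq> A \<or> S \<subseteq> B" by blast
  qed
next
  assume R: "S \<subseteq> Y \<and> irreducible_in T S"
  show "irreducible_in (subtopology T Y) S"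
    unfolding irreducible_in_def
  proof (intro conjI allI impI)
    show "S \<subseteq> topspace (subtopology T Y)" "S \<noteq> {}"
      using R unfolding irreducible_in_def by auto
    fix A B assume "closedin (subtopology T Y) A" "closedin (subtopology T Y) B" "S \<subseteq> A \<union> B"
    then obtain A' B' where "closedin T A'" "A = A' \<inter> Y" "closedin T B'" "B = B' \<inter> Y"
      by (auto simp: closedin_subtopology)
    moreover from this have "S \<subseteq> A' \<or> S \<subseteq> B'"
      using R \<open>S \<subseteq> A \<union> B\<close> unfolding irreducible_in_def by (simp add: subset_iff)
    ultimately show "S \<subseteq> A \<or> S \<subseteq> B"
      using R by blast
  qed
qed

lemma irreducible_in_closure_of:
  assumes "irreducible_in T S"
  shows "irreducible_in T (T closure_of S)"
  unfolding irreducible_in_def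
proof (intro conjI allI impI)
  have S: "S \<subseteq> T closure_of S" "S \<noteq> {}"
    using assms unfolding irreducible_in_def by (simp_all add: closure_of_subset)
  then show "T closure_of S \<noteq> {}" by blast
  fix A B assume AB: "closedin T A" "closedin T B" "T closure_of S \<subseteq> A \<union> B"
  then have "S \<subseteq> A \<or> S \<subseteq> B"
    using assms S unfolding irreducible_in_def by (meson subset_trans)
  then show "T closure_of S \<subseteq> A \<or> T closure_of S \<subseteq> B"
    using AB closure_of_minimal by metis
qed (rule closure_of_subset_topspace)

lemma irreducible_in_finite_Union:
  assumes "irreducible_in T S" "finite \<K>" "\<And>K. K \<in> \<K> \<Longrightarrow> closedin T K" "S \<subseteq> \<Union>\<K>"
  shows "\<exists>K\<in>\<K>. S \<subseteq> K"
  using assms(2-4)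
proof (induction \<K>)
  case empty
  then show ?case using assms(1) unfolding irreducible_in_def by auto
next
  case (insert K \<K>)
  have "closedin T (\<Union>\<K>)"
    using insert by (intro closedin_Union) auto
  then have "S \<subseteq> K \<or> S \<subseteq> \<Union>\<K>"
    using assms(1) insert.prems unfolding irreducible_in_def by simp
  then show ?case using insert by auto
qed

text \<open>Openness makes the closures incomparable: an open member lying in the closure of another
  one meets it, and disjointness makes them equal.\<close>

lemma irr_components_eq:
  assumes "finite \<O>" "\<And>U. U \<in> \<O> \<Longrightarrow> irreducible_in T U" "\<And>U. U \<in> \<O> \<Longrightarrow> openin T U"
    and "pairwise disjnt \<O>" "topspace T \<subseteq> (\<Union>U\<in>\<O>. T closure_of U)"
  shows "{C. irr_component T C} = (\<lambda>U. T closure_of U) ` \<O>"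
    and "inj_on (\<lambda>U. T closure_of U) \<O>"
proof -
  have sub: "U = V" if "U \<in> \<O>" "V \<in> \<O>" "T closure_of U \<subseteq> T closure_of V" for U V
  proof -
    have "U \<noteq> {}" "U \<subseteq> T closure_of V"
      using assms(2,3) that closure_of_subset[OF openin_subset, of T U]
      unfolding irreducible_in_def by auto
    then have "U \<inter> V \<noteq> {}"
      using openin_Int_closure_of_eq_empty[OF assms(3)[OF that(1)]] by blast
    then show ?thesis
      using assms(4) that unfolding pairwise_def disjnt_def by blast
  qed
  show "inj_on (\<lambda>U. T closure_of U) \<O>"
    by (intro inj_onI sub) auto
  have in_one: "\<exists>U\<in>\<O>. S \<subseteq> T closure_of U" if "irreducible_in T S" for S
  proof -
    have "S \<subseteq> \<Union> ((\<lambda>U. T closure_of U) ` \<O>)"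
      using assms(5) that unfolding irreducible_in_def by blast
    then have "\<exists>K\<in>(\<lambda>U. T closure_of U) ` \<O>. S \<subseteq> K"
      using assms(1) by (intro irreducible_in_finite_Union[OF that]) auto
    then show ?thesis by blast
  qed
  show "{C. irr_component T C} = (\<lambda>U. T closure_of U) ` \<O>"
  proof (intro equalityI subsetI)
    fix C assume "C \<in> {C. irr_component T C}"
    then have C: "irreducible_in T C" "\<And>S. irreducible_in T S \<Longrightarrow> C \<subseteq> S \<Longrightarrow> S = C"
      unfolding irr_component_def by auto
    then obtain U where U: "U \<in> \<O>" "C \<subseteq> T closure_of U"
      using in_one by blast
    have "irreducible_in T (T closure_of U)"
      using U assms(2) irreducible_in_closure_of by metis
    then have "T closure_of U = C"
      using C(2) U(2) by blast
    with U show "C \<in> (\<lambda>U. T closure_of U) ` \<O>" by blast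
  next
    fix C assume "C \<in> (\<lambda>U. T closure_of U) ` \<O>"
    then obtain U where U: "U \<in> \<O>" "C = T closure_of U" by blast
    have "S = C" if S: "irreducible_in T S" "C \<subseteq> S" for S
    proof -
      obtain V where V: "V \<in> \<O>" "S \<subseteq> T closure_of V"
        using in_one S by blast
      then have "U = V" using sub U S by blast
      then show ?thesis using U V S by blast
    qed
    moreover have "irreducible_in T C"
      using U assms(2) irreducible_in_closure_of by metis
    ultimately show "C \<in> {C. irr_component T C}"
      unfolding irr_component_def by simp
  qed
qed

lemma irreducible_rational_image:
  assumes "rational_map D \<phi>" "D p\<^sub>0 \<noteq> 0"
  shows "irreducible_in zariski (\<phi> ` {p. D p \<noteq> 0})"
  unfolding irreducible_in_def
proof (intro conjI allI impI)
  show "\<phi> ` {p. D p \<noteq> 0} \<noteq> {}" using assms(2) by auto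
  fix A B assume AB: "closedin zariski A" "closedin zariski B" "\<phi> ` {p. D p \<noteq> 0} \<subseteq> A \<union> B"
  show "\<phi> ` {p. D p \<noteq> 0} \<subseteq> A \<or> \<phi> ` {p. D p \<noteq> 0} \<subseteq> B"
  proof (rule ccontr)
    assume "\<not> ?thesis"
    then obtain p q where p: "D p \<noteq> 0" "\<phi> p \<notin> A" and q: "D q \<noteq> 0" "\<phi> q \<notin> B" by blast
    obtain f where f: "f \<in> polyfun" "\<And>s. s \<in> A \<Longrightarrow> f s = 0" "f (\<phi> p) \<noteq> 0"
      using zariski_closed_separate p(2) AB(1) unfolding closedin_zariski by metis
    obtain g where g: "g \<in> polyfun" "\<And>s. s \<in> B \<Longrightarrow> g s = 0" "g (\<phi> q) \<noteq> 0"
      using zariski_closed_separate q(2) AB(2) unfolding closedin_zariski by metis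
    obtain k h where h: "h \<in> polyfun" "\<And>p. D p \<noteq> 0 \<Longrightarrow> D p ^ k * f (\<phi> p) = h p"
      using rational_map_compose[OF assms(1) f(1)] by blast
    obtain l m where m: "m \<in> polyfun" "\<And>p. D p \<noteq> 0 \<Longrightarrow> D p ^ l * g (\<phi> p) = m p"
      using rational_map_compose[OF assms(1) g(1)] by blast
    have D: "D \<in> polyfun" using assms(1) unfolding rational_map_def by blast
    \<comment> \<open>The factor \<open>D p\<close> covers the points where \<open>D\<close>
      vanishes; there \<open>h\<close> and \<open>m\<close> say nothing about \<open>f\<close> and
      \<open>g\<close>.\<close>
    have zero: "h p * (D p * m p) = 0" for p
    proof (cases "D p = 0")
      case False
      then have "f (\<phi> p) = 0 \<or> g (\<phi> p) = 0" using AB(3) f(2) g(2) by blast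
      then show ?thesis by (auto simp flip: h(2)[OF False] m(2)[OF False])
    qed simp
    have "h p \<noteq> 0" using p(1) f(3) by (simp flip: h(2)[OF p(1)])
    then have "D q * m q = 0"
      using polyfun_mult_eq_0[OF h(1) pmult[OF D m(1)] zero] by blast
    then show False using q(1) g(3) by (simp flip: m(2)[OF q(1)])
  qed
qed simp

section \<open>Dimension of the image of a rational map\<close>

text \<open>Gaussian elimination: equation \<open>i\<close> with pivot \<open>A i k\<close>
  expresses the unknown \<open>k\<close> through the others, and \<open>B\<close> is the system left
  after substitution.\<close>

lemma homogeneous_system_solvable:
  fixes A :: "'i \<Rightarrow> 'j \<Rightarrow> 'a :: field"
  assumes "finite I" "finite J" "card I < card J"
  shows "\<exists>x. (\<exists>j\<in>J. x j \<noteq> 0) \<and> (\<forall>i\<in>I. (\<Sum>j\<in>J. A i j * x j) = 0)"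
  using assms
proof (induction I arbitrary: J A)
  case empty
  then have "J \<noteq> {}" by auto
  then show ?case by (intro exI[of _ "\<lambda>_. 1"]) auto
next
  case (insert i I)
  show ?case
  proof (cases "\<exists>j\<in>J. A i j \<noteq> 0")
    case False
    moreover obtain x where "\<exists>j\<in>J. x j \<noteq> 0" "\<forall>i\<in>I. (\<Sum>j\<in>J. A i j * x j) = 0"
      using insert.IH[of J A] insert.prems insert.hyps by auto
    ultimately show ?thesis by (intro exI[of _ x]) auto
  next
    case True
    then obtain k where k: "k \<in> J" "A i k \<noteq> 0" by blast
    define B where "B = (\<lambda>i' j. A i' j - A i' k * A i j / A i k)"
    have "card I < card (J - {k})"
      using insert.prems insert.hyps k by simp
    then obtain x where x: "\<exists>j\<in>J - {k}. x j \<noteq> 0" "\<And>i. i \<in> I \<Longrightarrow> (\<Sum>j\<in>J - {k}. B i j * x j) = 0"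
      using insert.IH[of "J - {k}" B] insert.prems by blast
    define c where "c = (\<Sum>j\<in>J - {k}. A i j * x j) / A i k"
    define y where "y = x(k := - c)"
    have sum_y: "(\<Sum>j\<in>J. a j * y j) = (\<Sum>j\<in>J - {k}. a j * x j) - a k * c" for a
    proof -
      have "(\<Sum>j\<in>J. a j * y j) = a k * y k + (\<Sum>j\<in>J - {k}. a j * y j)"
        using k insert.prems by (simp add: sum.remove)
      also have "(\<Sum>j\<in>J - {k}. a j * y j) = (\<Sum>j\<in>J - {k}. a j * x j)"
        by (rule sum.cong) (auto simp: y_def)
      finally show ?thesis by (simp add: y_def)
    qed
    have "(\<Sum>j\<in>J. A i j * y j) = 0"
      unfolding sum_y c_def using k by simp
    moreover have "(\<Sum>j\<in>J. A i' j * y j) = 0" if "i' \<in> I" for i'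
    proof -
      have "(\<Sum>j\<in>J - {k}. B i' j * x j) =
          (\<Sum>j\<in>J - {k}. A i' j * x j) - (\<Sum>j\<in>J - {k}. A i' k * (A i j * x j) / A i k)"
        unfolding B_def sum_subtractf [symmetric] by (simp add: algebra_simps)
      also have "\<dots> = (\<Sum>j\<in>J - {k}. A i' j * x j) - A i' k * c"
        unfolding c_def by (simp add: sum_distrib_left sum_divide_distrib)
      finally show ?thesis unfolding sum_y using x(2)[OF that] by simp
    qed
    moreover have "\<exists>j\<in>J. y j \<noteq> 0"
      using x(1) unfolding y_def by auto
    ultimately show ?thesis by (intro exI[of _ y]) auto
  qed
qed

section \<open>Degree bounds in each variable separately\<close>

definition deg_le :: "(('p \<Rightarrow> complex) \<Rightarrow> complex) \<Rightarrow> nat \<Rightarrow> bool" where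
  "deg_le f n \<longleftrightarrow> (\<forall>p v. \<exists>P. degree P \<le> n \<and> (\<forall>t. f (p(v := t)) = poly P t))"

lemma deg_leE:
  assumes "deg_le f n"
  obtains P where "degree P \<le> n" "\<And>t. f (p(v := t)) = poly P t"
  using assms unfolding deg_le_def by blast

lemma deg_le_mono: "deg_le f m \<Longrightarrow> m \<le> n \<Longrightarrow> deg_le f n"
  unfolding deg_le_def by (meson order_trans)

lemma deg_le_const: "deg_le (\<lambda>p. a) n"
  unfolding deg_le_def by (intro allI exI[of _ "[:a:]"]) simp

lemma deg_le_var: "deg_le (\<lambda>p. p v) 1"
  unfolding deg_le_def
proof (intro allI)
  fix p :: "'a \<Rightarrow> complex" and w
  show "\<exists>P. degree P \<le> 1 \<and> (\<forall>t. (p(w := t)) v = poly P t)"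
    by (cases "v = w") (auto intro: exI[of _ "[:0, 1:]"] exI[of _ "[:p v:]"])
qed

lemma deg_le_add:
  assumes "deg_le f n" "deg_le g n"
  shows "deg_le (\<lambda>p. f p + g p) n"
  unfolding deg_le_def
proof (intro allI)
  fix p v
  obtain P where "degree P \<le> n" "\<And>t. f (p(v := t)) = poly P t" using deg_leE[OF assms(1)] by blast
  moreover obtain Q where "degree Q \<le> n" "\<And>t. g (p(v := t)) = poly Q t" using deg_leE[OF assms(2)] by blast
  ultimately show "\<exists>P. degree P \<le> n \<and> (\<forall>t. f (p(v := t)) + g (p(v := t)) = poly P t)"
    by (intro exI[of _ "P + Q"]) (simp add: degree_add_le)
qed

lemma deg_le_mult:
  assumes "deg_le f m" "deg_le g n"
  shows "deg_le (\<lambda>p. f p * g p) (m + n)"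
  unfolding deg_le_def
proof (intro allI)
  fix p v
  obtain P where "degree P \<le> m" "\<And>t. f (p(v := t)) = poly P t" using deg_leE[OF assms(1)] by blast
  moreover obtain Q where "degree Q \<le> n" "\<And>t. g (p(v := t)) = poly Q t" using deg_leE[OF assms(2)] by blast
  ultimately show "\<exists>P. degree P \<le> m + n \<and> (\<forall>t. f (p(v := t)) * g (p(v := t)) = poly P t)"
    by (intro exI[of _ "P * Q"]) (simp add: order_trans[OF degree_mult_le])
qed

lemma deg_le_power: "deg_le f n \<Longrightarrow> deg_le (\<lambda>p. f p ^ k) (k * n)"
  by (induction k) (auto intro: deg_le_const deg_le_mult)

lemma deg_le_sum: "(\<And>i. i \<in> I \<Longrightarrow> deg_le (f i) n) \<Longrightarrow> deg_le (\<lambda>p. \<Sum>i\<in>I. f i p) n"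
  by (induction I rule: infinite_finite_induct) (auto intro: deg_le_const deg_le_add)

lemma polyfun_deg_le: "f \<in> polyfun \<Longrightarrow> \<exists>n. deg_le f n"
proof (induction rule: polyfun.induct)
  case (padd f g)
  then obtain m n where "deg_le f m" "deg_le g n" by blast
  then have "deg_le (\<lambda>p. f p + g p) (max m n)"
    by (intro deg_le_add) (auto elim: deg_le_mono)
  then show ?case by blast
qed (blast intro: deg_le_const deg_le_var deg_le_mult)+

text \<open>The coordinates are freed from the grid one at a time; \<open>V\<close> is the set of
  those already arbitrary. In a single coordinate, \<open>n + 1\<close> zeros kill a polynomial of
  degree at most \<open>n\<close>.\<close>

lemma zero_on_grid_imp_zero:
  fixes f :: "('p::finite \<Rightarrow> complex) \<Rightarrow> complex"
  assumes "deg_le f n" "\<And>p. (\<And>v. p v \<in> of_nat ` {..n}) \<Longrightarrow> f p = 0"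
  shows "f p = 0"
proof -
  have "\<forall>p. (\<forall>v. v \<notin> V \<longrightarrow> p v \<in> of_nat ` {..n}) \<longrightarrow> f p = 0" for V :: "'p set"
  proof -
    have "finite V" by simp
    then show ?thesis
    proof (induction V)
      case empty
      then show ?case using assms(2) by blast
    next
      case (insert v V)
      show ?case
      proof (intro allI impI)
        fix p :: "'p \<Rightarrow> complex"
        assume p: "\<forall>w. w \<notin> insert v V \<longrightarrow> p w \<in> of_nat ` {..n}"
        obtain P where P: "degree P \<le> n" "\<And>t. f (p(v := t)) = poly P t"
          using deg_leE[OF assms(1)] by blast
        have "poly P t = 0" if "t \<in> of_nat ` {..n}" for t
          unfolding P(2)[symmetric] using that p insert.IH by simp
        then have sub: "of_nat ` {..n} \<subseteq> {t. poly P t = 0}" by blast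
        have "P = 0"
        proof (rule ccontr)
          assume "P \<noteq> 0"
          then have "card (of_nat ` {..n} :: complex set) \<le> degree P"
            using card_mono[OF poly_roots_finite sub] card_poly_roots_bound order_trans by blast
          then show False using P(1) by (simp add: card_image inj_on_def)
        qed
        then show "f p = 0" using P(2)[of "p v"] by simp
      qed
    qed
  qed
  from this[of UNIV] show ?thesis by simp
qed

text \<open>The exponent of \<open>f i\<close> is the entry of the list preceded by \<open>i\<close> places from the end,
  so that the head of the list belongs to the function with the highest index.\<close>

fun monomial :: "(nat \<Rightarrow> 'a \<Rightarrow> complex) \<Rightarrow> nat list \<Rightarrow> 'a \<Rightarrow> complex" where
  "monomial f [] p = 1"
| "monomial f (m # ms) p = f (length ms) p ^ m * monomial f ms p"

definition exponents :: "nat \<Rightarrow> nat \<Rightarrow> nat list set" where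
  "exponents M n = {ms. set ms \<subseteq> {..M} \<and> length ms = n}"

lemma finite_exponents [simp]: "finite (exponents M n)"
  unfolding exponents_def by (rule finite_lists_length_eq) simp

lemma card_exponents: "card (exponents M n) = Suc M ^ n"
  unfolding exponents_def by (simp add: card_lists_length_eq)

lemma exponents_0 [simp]: "exponents M 0 = {[]}"
  unfolding exponents_def by auto

lemma sum_exponents_Suc:
  "(\<Sum>ms\<in>exponents M (Suc n). F ms) = (\<Sum>m\<le>M. \<Sum>ms\<in>exponents M n. F (m # ms))"
proof -
  have "exponents M (Suc n) = (\<lambda>(m, ms). m # ms) ` ({..M} \<times> exponents M n)"
    unfolding exponents_def by (auto simp: length_Suc_conv image_def)
  moreover have "inj_on (\<lambda>(m, ms). m # ms) ({..M} \<times> exponents M n)"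
    by (auto intro: inj_onI)
  ultimately show ?thesis
    by (simp add: sum.reindex case_prod_unfold sum.cartesian_product)
qed

lemma polyfun_monomial:
  "(\<And>i. i < length ms \<Longrightarrow> f i \<in> polyfun) \<Longrightarrow> monomial f ms \<in> polyfun"
proof (induction ms)
  case Nil
  have "monomial f [] = (\<lambda>p. 1)" by (rule ext) simp
  then show ?case by (simp add: pconst)
next
  case (Cons m ms)
  have "monomial f (m # ms) = (\<lambda>p. f (length ms) p ^ m * monomial f ms p)" by (rule ext) simp
  then show ?case using Cons by (auto intro!: polyfun_intros)
qed

text \<open>The coordinate ring of an irreducible set is a domain, which allows a power of a
  function to be cancelled from a relation.\<close>

lemma irreducible_in_zariski_mult:
  assumes "irreducible_in (subtopology zariski Y) Z" "f \<in> polyfun" "g \<in> polyfun"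
    "\<And>z. z \<in> Z \<Longrightarrow> f z * g z = 0" "z\<^sub>0 \<in> Z" "f z\<^sub>0 \<noteq> 0" "z \<in> Z"
  shows "g z = 0"
proof -
  have "irreducible_in zariski Z" using assms(1) by (simp add: irreducible_in_subtopology)
  moreover have "closedin zariski {p. f p = 0}" "closedin zariski {p. g p = 0}"
    using assms(2,3) by (simp_all add: closedin_zariski zariski_closed_zeros)
  moreover have "Z \<subseteq> {p. f p = 0} \<union> {p. g p = 0}" using assms(4) by auto
  ultimately have "Z \<subseteq> {p. f p = 0} \<or> Z \<subseteq> {p. g p = 0}"
    unfolding irreducible_in_def by blast
  then show ?thesis using assms(5-7) by auto
qed

text \<open>Functions separating the members of a chain are algebraically independent on its top:
  after division by the lowest power of the last function, a relation can be restricted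
  to the previous member, where that function vanishes.\<close>

lemma chain_independent:
  assumes "\<And>i. i \<le> n \<Longrightarrow> irreducible_in (subtopology zariski Y) (Z i)"
    and "\<And>i. i < n \<Longrightarrow> Z i \<subseteq> Z (Suc i)"
    and "\<And>i. i < n \<Longrightarrow> f i \<in> polyfun"
    and "\<And>i z. i < n \<Longrightarrow> z \<in> Z i \<Longrightarrow> f i z = 0"
    and "\<And>i. i < n \<Longrightarrow> \<exists>z\<in>Z (Suc i). f i z \<noteq> 0"
    and "\<And>z. z \<in> Z n \<Longrightarrow> (\<Sum>ms\<in>exponents M n. c ms * monomial f ms z) = 0"
    and "ms \<in> exponents M n"
  shows "c ms = 0"
  using assms
proof (induction n arbitrary: c ms)
  case 0
  have "Z 0 \<noteq> {}" using "0.prems"(1)[of 0] unfolding irreducible_in_def by simp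
  then show ?case using "0.prems"(6,7) by auto
next
  case (Suc n)
  \<comment> \<open>The coefficient of \<open>f n ^ m\<close> in the relation, a combination of
    monomials in the functions below \<open>n\<close>.\<close>
  define H where "H m z = (\<Sum>ms\<in>exponents M n. c (m # ms) * monomial f ms z)" for m z
  have H: "H m \<in> polyfun" for m
    unfolding H_def using Suc.prems(3)
    by (intro polyfun_intros polyfun_monomial) (auto simp: exponents_def)
  have fn: "f n \<in> polyfun" using Suc.prems(3) by simp
  have relation: "(\<Sum>m\<le>M. f n z ^ m * H m z) = 0" if "z \<in> Z (Suc n)" for z
  proof -
    have "(\<Sum>m\<le>M. f n z ^ m * H m z) = (\<Sum>ms\<in>exponents M (Suc n). c ms * monomial f ms z)"
      unfolding H_def sum_exponents_Suc sum_distrib_left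
      by (intro sum.cong refl) (auto simp: exponents_def)
    then show ?thesis using Suc.prems(6)[OF that] by simp
  qed
  obtain z\<^sub>0 where z0: "z\<^sub>0 \<in> Z (Suc n)" "f n z\<^sub>0 \<noteq> 0" using Suc.prems(5)[of n] by auto
  have "m \<le> M \<Longrightarrow> \<forall>ms\<in>exponents M n. c (m # ms) = 0" for m
  proof (induction m rule: less_induct)
    case (less m)
    \<comment> \<open>The terms above \<open>m\<close> with \<open>f n ^ Suc m\<close> taken out;
      the terms below \<open>m\<close> vanish by the inner induction.\<close>
    define R where "R z = (\<Sum>j\<in>{m<..M}. f n z ^ (j - Suc m) * H j z)" for z
    have R: "R \<in> polyfun"
      unfolding R_def using H fn by (intro polyfun_intros)
    have fact: "f n z ^ m * (H m z + f n z * R z) = 0" if "z \<in> Z (Suc n)" for z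
    proof -
      have "H j z = 0" if "j < m" for j
        unfolding H_def using less that by simp
      then have "(\<Sum>j\<le>M. f n z ^ j * H j z) = (\<Sum>j\<in>{m..M}. f n z ^ j * H j z)"
        by (intro sum.mono_neutral_right) auto
      also have "\<dots> = f n z ^ m * H m z + (\<Sum>j\<in>{m<..M}. f n z ^ j * H j z)"
        using less.prems by (simp add: sum.head)
      also have "(\<Sum>j\<in>{m<..M}. f n z ^ j * H j z) = f n z ^ m * (f n z * R z)"
        unfolding R_def sum_distrib_left
      proof (intro sum.cong refl)
        fix j assume "j \<in> {m<..M}"
        then have "j = m + Suc (j - Suc m)" by auto
        then have "f n z ^ j = f n z ^ m * (f n z * f n z ^ (j - Suc m))"
          by (metis power_Suc power_add)
        then show "f n z ^ j * H j z = f n z ^ m * (f n z * (f n z ^ (j - Suc m) * H j z))"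
          by simp
      qed
      finally show ?thesis using relation[OF that] by (simp add: algebra_simps)
    qed
    have "H m z + f n z * R z = 0" if "z \<in> Z (Suc n)" for z
    proof (rule irreducible_in_zariski_mult[where f = "\<lambda>z. f n z ^ m" and g = "\<lambda>z. H m z + f n z * R z"])
      show "irreducible_in (subtopology zariski Y) (Z (Suc n))" using Suc.prems(1) by simp
      show "(\<lambda>z. H m z + f n z * R z) \<in> polyfun" "(\<lambda>z. f n z ^ m) \<in> polyfun"
        by (intro padd pmult polyfun_power H R fn)+
    qed (use fact z0 that in auto)
    moreover have "f n z = 0" "z \<in> Z (Suc n)" if "z \<in> Z n" for z
      using Suc.prems(2,4)[of n] that by auto
    ultimately have "H m z = 0" if "z \<in> Z n" for z
      using that by (metis add.right_neutral mult_zero_left)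
    then show ?case
      using Suc.IH[of "\<lambda>ms. c (m # ms)"] Suc.prems(1-5) unfolding H_def by auto
  qed
  then show ?case using Suc.prems(7) unfolding exponents_def
    by (auto simp: length_Suc_conv)
qed

text \<open>Exponents below \<open>M\<close> are padded with powers of \<open>D p ^ K\<close>, so
  that the denominator depends on the length of \<open>ms\<close> alone and a linear combination of
  monomials can be cleared of denominators at once.\<close>

lemma monomial_common_denominator:
  fixes D :: "('p \<Rightarrow> complex) \<Rightarrow> complex"
  assumes "\<And>i. i < length ms \<Longrightarrow> deg_le (h i) e"
    and "\<And>i p. i < length ms \<Longrightarrow> D p \<noteq> 0 \<Longrightarrow> D p ^ K * f i (\<phi> p) = h i p"
    and "deg_le (\<lambda>p. D p ^ K) e" "set ms \<subseteq> {..M}"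
  shows "\<exists>H. deg_le H (length ms * (M * e)) \<and>
    (\<forall>p. D p \<noteq> 0 \<longrightarrow> D p ^ (K * M * length ms) * monomial f ms (\<phi> p) = H p)"
  using assms
proof (induction ms)
  case Nil
  then show ?case by (intro exI[of _ "\<lambda>p. 1"]) (simp add: deg_le_const)
next
  case (Cons m ms)
  then obtain H where H: "deg_le H (length ms * (M * e))"
    "\<And>p. D p \<noteq> 0 \<Longrightarrow> D p ^ (K * M * length ms) * monomial f ms (\<phi> p) = H p"
    by auto
  have m: "m \<le> M" using Cons.prems by simp
  have "deg_le (\<lambda>p. h (length ms) p ^ m * (D p ^ K) ^ (M - m)) (m * e + (M - m) * e)"
    using Cons.prems by (intro deg_le_mult deg_le_power) auto
  then have "deg_le (\<lambda>p. h (length ms) p ^ m * (D p ^ K) ^ (M - m)) (M * e)"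
    using m by (simp flip: add_mult_distrib)
  from deg_le_mult[OF this H(1)]
  have "deg_le (\<lambda>p. h (length ms) p ^ m * (D p ^ K) ^ (M - m) * H p) (length (m # ms) * (M * e))"
    by simp
  moreover have "D p ^ (K * M * length (m # ms)) * monomial f (m # ms) (\<phi> p)
      = h (length ms) p ^ m * (D p ^ K) ^ (M - m) * H p" if D: "D p \<noteq> 0" for p
  proof -
    have "D p ^ (K * M * length (m # ms))
        = (D p ^ K) ^ m * (D p ^ K) ^ (M - m) * D p ^ (K * M * length ms)"
      using m by (simp add: power_mult [symmetric] power_add [symmetric] algebra_simps)
    moreover have "h (length ms) p = D p ^ K * f (length ms) (\<phi> p)"
      using Cons.prems(2)[of "length ms", OF _ D] by simp
    ultimately show ?thesis
      unfolding H(2)[OF D, symmetric] monomial.simps by (simp only: power_mult_distrib mult_ac)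
  qed
  ultimately show ?case by blast
qed

lemma rational_map_uniform_denominator:
  fixes f :: "nat \<Rightarrow> ('v \<Rightarrow> complex) \<Rightarrow> complex"
  assumes "rational_map D \<phi>" "\<And>i. i < n \<Longrightarrow> f i \<in> polyfun"
  shows "\<exists>K e h. deg_le (\<lambda>p. D p ^ K) e \<and>
    (\<forall>i<n. deg_le (h i) e \<and> (\<forall>p. D p \<noteq> 0 \<longrightarrow> D p ^ K * f i (\<phi> p) = h i p))"
  using assms(2)
proof (induction n)
  case 0
  have "deg_le (\<lambda>p. D p ^ 0) 0" by (simp add: deg_le_const)
  then show ?case by blast
next
  case (Suc n)
  then obtain K e h where "deg_le (\<lambda>p. D p ^ K) e"
    "\<forall>i<n. deg_le (h i) e \<and> (\<forall>p. D p \<noteq> 0 \<longrightarrow> D p ^ K * f i (\<phi> p) = h i p)" by auto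
  then have IH: "deg_le (\<lambda>p. D p ^ K) e" "\<And>i. i < n \<Longrightarrow> deg_le (h i) e"
    "\<And>i p. i < n \<Longrightarrow> D p \<noteq> 0 \<Longrightarrow> D p ^ K * f i (\<phi> p) = h i p" by auto
  obtain k g where g: "g \<in> polyfun" "\<And>p. D p \<noteq> 0 \<Longrightarrow> D p ^ k * f n (\<phi> p) = g p"
    using rational_map_compose[OF assms(1), of "f n"] Suc.prems by auto
  have "D \<in> polyfun" using assms(1) unfolding rational_map_def by blast
  then obtain d where d: "deg_le D d" using polyfun_deg_le by blast
  obtain d' where d': "deg_le g d'" using polyfun_deg_le[OF g(1)] by blast
  define E where "E = e + k * d + d'"
  define h' where "h' i p = (if i = n then D p ^ K * g p else D p ^ k * h i p)" for i p
  have "deg_le (\<lambda>p. D p ^ K * D p ^ k) (e + k * d)"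
    by (intro deg_le_mult deg_le_power IH d)
  then have "deg_le (\<lambda>p. D p ^ (K + k)) E"
    unfolding power_add by (rule deg_le_mono) (simp add: E_def)
  moreover have "deg_le (h' i) E" if "i < Suc n" for i
  proof (cases "i = n")
    case True
    have "deg_le (\<lambda>p. D p ^ K * g p) (e + d')" by (intro deg_le_mult IH d')
    then show ?thesis unfolding h'_def True by (auto elim: deg_le_mono simp: E_def)
  next
    case False
    have "deg_le (\<lambda>p. D p ^ k * h i p) (k * d + e)"
      using False that by (intro deg_le_mult deg_le_power IH d) auto
    then show ?thesis unfolding h'_def using False by (auto elim: deg_le_mono simp: E_def)
  qed
  moreover have "D p ^ (K + k) * f i (\<phi> p) = h' i p" if "i < Suc n" "D p \<noteq> 0" for i p
    using that g(2)[OF that(2)] IH(3)[of i, OF _ that(2)]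
    by (auto simp: h'_def power_add mult_ac less_Suc_eq)
  ultimately show ?case by blast
qed

text \<open>Once denominators are cleared, every monomial becomes a function of degree at most
  \<open>N\<close> in each parameter, determined by its values on a grid of
  \<open>(N + 1) ^ CARD('p)\<close> points, where \<open>N\<close> is linear in \<open>M\<close>.
  Each grid point gives one equation for the coefficients, and for large \<open>M\<close> the
  \<open>(M + 1) ^ n\<close> monomials outnumber them.\<close>

lemma rational_image_dependent:
  fixes \<phi> :: "('p::finite \<Rightarrow> complex) \<Rightarrow> 'v \<Rightarrow> complex" and n :: nat
  assumes "rational_map D \<phi>" "\<And>i. i < n \<Longrightarrow> f i \<in> polyfun" "n > CARD('p)"
  shows "\<exists>M c. (\<exists>ms\<in>exponents M n. c ms \<noteq> 0) \<and>
    (\<forall>p. D p \<noteq> 0 \<longrightarrow> (\<Sum>ms\<in>exponents M n. c ms * monomial f ms (\<phi> p)) = 0)"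
proof -
  obtain K e h where "deg_le (\<lambda>p. D p ^ K) e"
    "\<forall>i<n. deg_le (h i) e \<and> (\<forall>p. D p \<noteq> 0 \<longrightarrow> D p ^ K * f i (\<phi> p) = h i p)"
    using rational_map_uniform_denominator[OF assms(1), of n f] assms(2) by blast
  then have h: "deg_le (\<lambda>p. D p ^ K) e" "\<And>i. i < n \<Longrightarrow> deg_le (h i) e"
    "\<And>i p. i < n \<Longrightarrow> D p \<noteq> 0 \<Longrightarrow> D p ^ K * f i (\<phi> p) = h i p" by auto
  define m where "m = CARD('p)"
  \<comment> \<open>This choice gives \<open>(N + 1) ^ m \<le> (n * e + 1) ^ m * (M + 1) ^ m = M *
    (M + 1) ^ m < (M + 1) ^ Suc m\<close>.\<close>
  define M where "M = Suc (n * e) ^ m"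
  define N where "N = n * (M * e)"
  have "\<exists>H. deg_le H N \<and> (\<forall>p. D p \<noteq> 0 \<longrightarrow> D p ^ (K * M * n) * monomial f ms (\<phi> p) = H p)"
    if "ms \<in> exponents M n" for ms
    using monomial_common_denominator[of ms h e D K f \<phi> M] h that
    unfolding exponents_def N_def by auto
  then obtain H where H: "\<And>ms. ms \<in> exponents M n \<Longrightarrow> deg_le (H ms) N"
    "\<And>ms p. ms \<in> exponents M n \<Longrightarrow> D p \<noteq> 0 \<Longrightarrow> D p ^ (K * M * n) * monomial f ms (\<phi> p) = H ms p"
    by metis
  define grid where "grid = (UNIV :: 'p set) \<rightarrow>\<^sub>E (of_nat ` {..N} :: complex set)"
  have "finite grid" unfolding grid_def by (intro finite_PiE) auto
  have card_grid: "card grid = Suc N ^ m"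
    unfolding grid_def m_def by (simp add: card_PiE card_image inj_on_def)
  have "Suc N \<le> Suc (n * e) * Suc M"
    unfolding N_def by (simp add: algebra_simps)
  then have "Suc N ^ m \<le> (Suc (n * e) * Suc M) ^ m"
    by (rule power_mono) simp
  also have "\<dots> = M * Suc M ^ m"
    unfolding M_def by (rule power_mult_distrib)
  also have "\<dots> < Suc M ^ Suc m"
    by simp
  also have "\<dots> \<le> Suc M ^ n"
    using assms(3) unfolding m_def by (intro power_increasing) auto
  finally have "card grid < card (exponents M n)"
    by (simp add: card_grid card_exponents)
  from homogeneous_system_solvable[OF \<open>finite grid\<close> finite_exponents this, of "\<lambda>p ms. H ms p"]
  obtain c where c: "\<exists>ms\<in>exponents M n. c ms \<noteq> 0"
    "\<And>p. p \<in> grid \<Longrightarrow> (\<Sum>ms\<in>exponents M n. H ms p * c ms) = 0" by blast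
  have zero: "(\<Sum>ms\<in>exponents M n. H ms p * c ms) = 0" for p
  proof (rule zero_on_grid_imp_zero[where f = "\<lambda>p. \<Sum>ms\<in>exponents M n. H ms p * c ms" and n = N])
    show "deg_le (\<lambda>p. \<Sum>ms\<in>exponents M n. H ms p * c ms) N"
      using deg_le_mult[OF H(1) deg_le_const[of _ 0]] by (intro deg_le_sum) auto
  qed (intro c(2), unfold grid_def, rule PiE_I, auto)
  have "(\<Sum>ms\<in>exponents M n. c ms * monomial f ms (\<phi> p)) = 0" if "D p \<noteq> 0" for p
  proof -
    have "D p ^ (K * M * n) * (\<Sum>ms\<in>exponents M n. c ms * monomial f ms (\<phi> p))
        = (\<Sum>ms\<in>exponents M n. H ms p * c ms)"
      unfolding sum_distrib_left by (intro sum.cong refl) (simp flip: H(2) add: that)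
    then show ?thesis using zero that by simp
  qed
  with c(1) show ?thesis by blast
qed

text \<open>A relation valid on the image holds on its closure, since its zero set is closed, and in
  particular on the top of a chain. With more functions than parameters such a relation exists and
  contradicts \<open>chain_independent\<close>.\<close>

lemma chain_len_rational_closure:
  fixes \<phi> :: "('p::finite \<Rightarrow> complex) \<Rightarrow> 'v \<Rightarrow> complex"
  assumes "rational_map D \<phi>" "Y \<subseteq> zariski closure_of (\<phi> ` {p. D p \<noteq> 0})"
    and "chain_len (subtopology zariski Y) n"
  shows "n \<le> CARD('p)"
proof (rule ccontr)
  assume "\<not> n \<le> CARD('p)"
  obtain Z where Z: "\<And>i. i \<le> n \<Longrightarrow> closedin (subtopology zariski Y) (Z i)"
    "\<And>i. i \<le> n \<Longrightarrow> irreducible_in (subtopology zariski Y) (Z i)"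
    "\<And>i. i < n \<Longrightarrow> Z i \<subset> Z (Suc i)"
    using assms(3) unfolding chain_len_def by blast
  have "\<exists>g\<in>polyfun. (\<forall>z\<in>Z i. g z = 0) \<and> (\<exists>z\<in>Z (Suc i). g z \<noteq> 0)" if i: "i < n" for i
  proof -
    obtain z where z: "z \<in> Z (Suc i)" "z \<notin> Z i" using Z(3)[OF i] by auto
    obtain C where C: "closedin zariski C" "Z i = C \<inter> Y"
      using Z(1)[of i] i by (auto simp: closedin_subtopology)
    have "Z (Suc i) \<subseteq> Y"
      using closedin_subset[OF Z(1)[of "Suc i"]] i by auto
    then have "z \<notin> C" using z C(2) by auto
    then obtain g where "g \<in> polyfun" "\<And>s. s \<in> C \<Longrightarrow> g s = 0" "g z \<noteq> 0"
      using zariski_closed_separate C(1) unfolding closedin_zariski by metis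
    then show ?thesis using z(1) C(2) by auto
  qed
  then obtain f where f: "\<And>i. i < n \<Longrightarrow> f i \<in> polyfun" "\<And>i z. i < n \<Longrightarrow> z \<in> Z i \<Longrightarrow> f i z = 0"
    "\<And>i. i < n \<Longrightarrow> \<exists>z\<in>Z (Suc i). f i z \<noteq> 0"
    by metis
  have "CARD('p) < n" using \<open>\<not> n \<le> CARD('p)\<close> by simp
  then have "\<exists>M c. (\<exists>ms\<in>exponents M n. c ms \<noteq> 0) \<and>
      (\<forall>p. D p \<noteq> 0 \<longrightarrow> (\<Sum>ms\<in>exponents M n. c ms * monomial f ms (\<phi> p)) = 0)"
    by (intro rational_image_dependent assms(1) f(1))
  then obtain M c where c: "\<exists>ms\<in>exponents M n. c ms \<noteq> 0"
    "\<And>p. D p \<noteq> 0 \<Longrightarrow> (\<Sum>ms\<in>exponents M n. c ms * monomial f ms (\<phi> p)) = 0"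
    by blast
  have "(\<lambda>z. \<Sum>ms\<in>exponents M n. c ms * monomial f ms z) \<in> polyfun"
    using f(1) by (intro polyfun_intros polyfun_monomial) (auto simp: exponents_def)
  then have "closedin zariski {z. (\<Sum>ms\<in>exponents M n. c ms * monomial f ms z) = 0}"
    by (simp add: closedin_zariski zariski_closed_zeros)
  then have "zariski closure_of (\<phi> ` {p. D p \<noteq> 0}) \<subseteq> {z. (\<Sum>ms\<in>exponents M n. c ms * monomial f ms z) = 0}"
    using c(2) by (intro closure_of_minimal) auto
  moreover have "Z n \<subseteq> Y" using closedin_subset[OF Z(1)[of n]] by auto
  ultimately have rel: "(\<Sum>ms\<in>exponents M n. c ms * monomial f ms z) = 0" if "z \<in> Z n" for z
    using assms(2) that by auto
  have "c ms = 0" if "ms \<in> exponents M n" for ms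
    by (rule chain_independent[OF Z(2) _ f rel that]) (use Z(3) in auto)
  with c(1) show False by blast
qed

section \<open>The group action and its orbits\<close>

lemma sum_idx: "(\<Sum>i\<in>UNIV. f i) = f E1 + f E2 + f F1"
  by (simp add: UNIV_idx add.assoc)

lemma all_idx: "(\<forall>i. P i) \<longleftrightarrow> P E1 \<and> P E2 \<and> P F1"
  by (metis idx.exhaust)

text \<open>The entries of an even matrix. As the index type of the parameters, its cardinality
  becomes the bound on the dimension.\<close>

datatype prm = P11 | P12 | P21 | P22 | PF

lemma UNIV_prm: "(UNIV :: prm set) = {P11, P12, P21, P22, PF}"
  using prm.exhaust by auto

instance prm :: finite
  by standard (simp add: UNIV_prm)

lemma CARD_prm: "CARD(prm) = 5"
  by (simp add: UNIV_prm)

fun gmat :: "(prm \<Rightarrow> complex) \<Rightarrow> idx \<Rightarrow> idx \<Rightarrow> complex" where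
  "gmat p E1 E1 = p P11" | "gmat p E1 E2 = p P12" | "gmat p E2 E1 = p P21" | "gmat p E2 E2 = p P22"
| "gmat p F1 F1 = p PF" | "gmat p _ _ = 0"

text \<open>Adjugate of the whole 3 x 3 block matrix, kept apart from the inverse
  \<open>hmat\<close> because it supplies the polynomial numerators of the action.\<close>

fun adjmat :: "(prm \<Rightarrow> complex) \<Rightarrow> idx \<Rightarrow> idx \<Rightarrow> complex" where
  "adjmat p E1 E1 = p PF * p P22" | "adjmat p E1 E2 = - (p PF * p P12)"
| "adjmat p E2 E1 = - (p PF * p P21)" | "adjmat p E2 E2 = p PF * p P11"
| "adjmat p F1 F1 = p P11 * p P22 - p P12 * p P21" | "adjmat p _ _ = 0"

definition gdet :: "(prm \<Rightarrow> complex) \<Rightarrow> complex" where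
  "gdet p = p PF * (p P11 * p P22 - p P12 * p P21)"

definition hmat :: "(prm \<Rightarrow> complex) \<Rightarrow> idx \<Rightarrow> idx \<Rightarrow> complex" where
  "hmat p i j = adjmat p i j / gdet p"

lemma app_gmat_hmat:
  assumes "gdet p \<noteq> 0"
  shows "app (gmat p) (app (hmat p) v) = v" and "app (hmat p) (app (gmat p) v) = v"
proof -
  have "app (gmat p) (app (hmat p) v) i = v i \<and> app (hmat p) (app (gmat p) v) i = v i" for i
    using assms by (cases i) (simp_all add: app_def sum_idx hmat_def field_simps,
      simp_all add: gdet_def algebra_simps)
  then show "app (gmat p) (app (hmat p) v) = v" and "app (hmat p) (app (gmat p) v) = v"
    by auto
qed

lemma gl_even_gmat: "gdet p \<noteq> 0 \<Longrightarrow> gl_even (gmat p)"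
  unfolding gl_even_def all_idx by (auto simp: app_gmat_hmat intro!: exI[of _ "hmat p"])

lemma gl_even_imp_gmat:
  assumes "gl_even g"
  obtains p where "gdet p \<noteq> 0" "g = gmat p"
proof -
  have par0: "g i j = 0" if "par i \<noteq> par j" for i j
    using assms that unfolding gl_even_def by blast
  obtain h where h: "\<And>v. app h (app g v) = v"
    using assms unfolding gl_even_def by blast
  have "app h (\<lambda>_. 0) = (\<lambda>_. 0)"
    by (simp add: app_def)
  then have inj: "v = (\<lambda>_. 0)" if "app g v = (\<lambda>_. 0)" for v
    using h[of v] that by simp
  define p where "p = (\<lambda>x. case x of P11 \<Rightarrow> g E1 E1 | P12 \<Rightarrow> g E1 E2 | P21 \<Rightarrow> g E2 E1
    | P22 \<Rightarrow> g E2 E2 | PF \<Rightarrow> g F1 F1)"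
  have gp: "g = gmat p"
  proof (intro ext)
    fix i j show "g i j = gmat p i j"
      by (cases i; cases j) (simp_all add: p_def par0)
  qed
  have app_gmat: "app g v = (\<lambda>i. case i of E1 \<Rightarrow> p P11 * v E1 + p P12 * v E2
      | E2 \<Rightarrow> p P21 * v E1 + p P22 * v E2 | F1 \<Rightarrow> p PF * v F1)" for v
    by (rule ext) (auto simp: gp app_def sum_idx split: idx.split)
  have "p PF \<noteq> 0"
  proof
    assume "p PF = 0"
    then have "app g (\<lambda>i. if i = F1 then 1 else 0) = (\<lambda>_. 0)"
      unfolding app_gmat by (auto split: idx.split)
    from inj[OF this] show False by (meson one_neq_zero)
  qed
  moreover have "p P11 * p P22 - p P12 * p P21 \<noteq> 0"
  proof
    assume det: "p P11 * p P22 - p P12 * p P21 = 0"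
    \<comment> \<open>Up to sign, the columns of the adjugate of the even block. For a singular
      block they lie in the kernel, so injectivity makes all four entries zero.\<close>
    have 1: "app g (\<lambda>i. case i of E1 \<Rightarrow> p P22 | E2 \<Rightarrow> - p P21 | F1 \<Rightarrow> 0) = (\<lambda>_. 0)"
      "app g (\<lambda>i. case i of E1 \<Rightarrow> p P12 | E2 \<Rightarrow> - p P11 | F1 \<Rightarrow> 0) = (\<lambda>_. 0)"
      unfolding app_gmat using det by (auto split: idx.split simp: algebra_simps)
    have "p P22 = 0" "p P21 = 0" "p P12 = 0" "p P11 = 0"
      using fun_cong[OF inj[OF 1(1)], of E1] fun_cong[OF inj[OF 1(1)], of E2]
        fun_cong[OF inj[OF 1(2)], of E1] fun_cong[OF inj[OF 1(2)], of E2] by auto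
    then have "app g (\<lambda>i. if i = E1 then 1 else 0) = (\<lambda>_. 0)"
      unfolding app_gmat by (auto split: idx.split)
    from inj[OF this] show False by (meson one_neq_zero)
  qed
  ultimately show ?thesis using that[of p] gp unfolding gdet_def by auto
qed

definition act :: "(idx \<Rightarrow> idx \<Rightarrow> complex) \<Rightarrow> (idx \<Rightarrow> idx \<Rightarrow> complex) \<Rightarrow> struc \<Rightarrow> struc" where
  "act g h c = (\<lambda>(i, j, k). \<Sum>a\<in>UNIV. \<Sum>b\<in>UNIV. \<Sum>m\<in>UNIV. g k m * c (a, b, m) * h a i * h b j)"

lemma mult_basis: "mult c (\<lambda>a. if a = i then 1 else 0) (\<lambda>a. if a = j then 1 else 0) k = c (i, j, k)"
  by (cases i; cases j) (simp_all add: mult_def sum_idx)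

lemma struc_eqI:
  assumes "\<And>x y. mult c x y = mult c' x y"
  shows "c = c'"
proof
  fix t :: "idx \<times> idx \<times> idx"
  obtain i j k where "t = (i, j, k)" by (metis prod_cases3)
  then show "c t = c' t"
    using assms by (simp flip: mult_basis)
qed

lemma mult_act: "mult (act g h c) x y = app g (mult c (app h x) (app h y))"
  by (rule ext) (simp add: mult_def act_def app_def sum_idx algebra_simps)

lemma mem_orbit_iff: "c' \<in> orbit c \<longleftrightarrow> (\<exists>p. gdet p \<noteq> 0 \<and> c' = act (gmat p) (hmat p) c)"
proof
  assume "c' \<in> orbit c"
  then obtain g where g: "gl_even g" "\<And>x y. mult c' (app g x) (app g y) = app g (mult c x y)"
    unfolding orbit_def by blast
  obtain p where p: "gdet p \<noteq> 0" "g = gmat p" using gl_even_imp_gmat[OF g(1)] by blast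
  have "mult c' x y = mult (act (gmat p) (hmat p) c) x y" for x y
    using g(2)[of "app (hmat p) x" "app (hmat p) y"] p by (simp add: mult_act app_gmat_hmat)
  then show "\<exists>p. gdet p \<noteq> 0 \<and> c' = act (gmat p) (hmat p) c"
    using struc_eqI p(1) by blast
next
  assume "\<exists>p. gdet p \<noteq> 0 \<and> c' = act (gmat p) (hmat p) c"
  then obtain p where "gdet p \<noteq> 0" "c' = act (gmat p) (hmat p) c" by blast
  then show "c' \<in> orbit c"
    unfolding orbit_def using gl_even_gmat
    by (auto simp: mult_act app_gmat_hmat intro!: exI[of _ "gmat p"])
qed

lemma orbitE:
  assumes "c' \<in> orbit c"
  obtains p where "gdet p \<noteq> 0" "\<And>x y. mult c' x y = app (gmat p) (mult c (app (hmat p) x) (app (hmat p) y))"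
  using assms unfolding mem_orbit_iff by (auto simp: mult_act)

lemma orbitI:
  assumes "gdet p \<noteq> 0"
    "\<And>x y. mult c' (app (gmat p) x) (app (gmat p) y) = app (gmat p) (mult c x y)"
  shows "c' \<in> orbit c"
  unfolding orbit_def using gl_even_gmat assms by blast

text \<open>Column \<open>i\<close> of \<open>gmat p\<close> is the image of basis vector
  \<open>i\<close> of \<open>c\<close> in the algebra \<open>c'\<close>; the hypothesis is
  multiplicativity on pairs of basis vectors.\<close>

lemma orbit_basisI:
  assumes "gdet p \<noteq> 0"
    "\<And>i j k. (\<Sum>a\<in>UNIV. \<Sum>b\<in>UNIV. gmat p a i * gmat p b j * c' (a, b, k)) = (\<Sum>m\<in>UNIV. gmat p k m * c (i, j, m))"
  shows "c' \<in> orbit c"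
proof (rule orbitI[OF assms(1)])
  fix x y
  show "mult c' (app (gmat p) x) (app (gmat p) y) = app (gmat p) (mult c x y)"
  proof
    fix k
    have "mult c' (app (gmat p) x) (app (gmat p) y) k =
      (\<Sum>i\<in>UNIV. \<Sum>j\<in>UNIV. x i * y j * (\<Sum>a\<in>UNIV. \<Sum>b\<in>UNIV. gmat p a i * gmat p b j * c' (a, b, k)))"
      unfolding mult_def app_def sum_idx by (simp add: algebra_simps)
    also have "\<dots> = app (gmat p) (mult c x y) k"
      unfolding assms(2) by (simp add: mult_def app_def sum_idx algebra_simps)
    finally show "mult c' (app (gmat p) x) (app (gmat p) y) k = app (gmat p) (mult c x y) k" .
  qed
qed

lemma orbit_refl [simp]: "c \<in> orbit c"
proof -
  let ?p = "\<lambda>x. if x = P12 \<or> x = P21 then 0 else 1 :: complex"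
  show ?thesis
  proof (rule orbit_basisI)
    show "gdet ?p \<noteq> 0" by (simp add: gdet_def)
    show "(\<Sum>a\<in>UNIV. \<Sum>b\<in>UNIV. gmat ?p a i * gmat ?p b j * c (a, b, k))
        = (\<Sum>m\<in>UNIV. gmat ?p k m * c (i, j, m))" for i j k
      by (cases i; cases j; cases k) (simp_all add: sum_idx)
  qed
qed

lemma orbit_sym:
  assumes "c' \<in> orbit c"
  shows "c \<in> orbit c'"
proof -
  obtain p where p: "gdet p \<noteq> 0" "\<And>x y. mult c' x y = app (gmat p) (mult c (app (hmat p) x) (app (hmat p) y))"
    using orbitE[OF assms] by blast
  have "gl_even (hmat p)"
    unfolding gl_even_def all_idx using app_gmat_hmat[OF p(1)] by (auto simp: hmat_def)
  then show ?thesis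
    unfolding orbit_def using p(2) app_gmat_hmat[OF p(1)] by (auto intro!: exI[of _ "hmat p"])
qed

lemma orbit_trans:
  assumes "c'' \<in> orbit c'" "c' \<in> orbit c"
  shows "c'' \<in> orbit c"
proof -
  obtain p where p: "gdet p \<noteq> 0" "\<And>x y. mult c'' x y = app (gmat p) (mult c' (app (hmat p) x) (app (hmat p) y))"
    using orbitE[OF assms(1)] by blast
  obtain q where q: "gdet q \<noteq> 0" "\<And>x y. mult c' x y = app (gmat q) (mult c (app (hmat q) x) (app (hmat q) y))"
    using orbitE[OF assms(2)] by blast
  let ?r = "\<lambda>x. case x of P11 \<Rightarrow> p P11 * q P11 + p P12 * q P21 | P12 \<Rightarrow> p P11 * q P12 + p P12 * q P22
    | P21 \<Rightarrow> p P21 * q P11 + p P22 * q P21 | P22 \<Rightarrow> p P21 * q P12 + p P22 * q P22 | PF \<Rightarrow> p PF * q PF"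
  have "app (gmat ?r) v i = app (gmat p) (app (gmat q) v) i" for v i
    by (cases i) (simp_all add: app_def sum_idx algebra_simps)
  then have r: "app (gmat ?r) v = app (gmat p) (app (gmat q) v)" for v
    by blast
  have "gdet ?r = gdet p * gdet q"
    by (simp add: gdet_def algebra_simps)
  then have "gdet ?r \<noteq> 0" using p(1) q(1) by simp
  then show ?thesis
    by (rule orbitI) (simp add: r p(2) q(2) app_gmat_hmat p(1) q(1))
qed

lemma orbit_eqI: "c' \<in> orbit c \<Longrightarrow> orbit c' = orbit c"
  using orbit_sym orbit_trans by blast

lemma polyfun_gdet: "gdet \<in> polyfun"
proof -
  have "(\<lambda>p. p PF * (p P11 * p P22 - p P12 * p P21)) \<in> polyfun"
    by (intro polyfun_intros)
  then show ?thesis by (simp flip: gdet_def)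
qed

lemma gdet_nonzero_ex: "\<exists>p. gdet p \<noteq> 0"
  by (rule exI[of _ "\<lambda>x. if x = P12 then 0 else 1"]) (simp add: gdet_def)

lemma polyfun_gmat: "(\<lambda>p. gmat p i j) \<in> polyfun"
  by (cases i; cases j) (auto intro!: polyfun_intros)

lemma polyfun_adjmat: "(\<lambda>p. adjmat p i j) \<in> polyfun"
  by (cases i; cases j) (auto intro!: polyfun_intros)

lemma rational_map_act: "rational_map gdet (\<lambda>p. act (gmat p) (hmat p) c)"
  unfolding rational_map_def
proof (intro conjI allI)
  fix t :: "idx \<times> idx \<times> idx"
  obtain i j k where t: "t = (i, j, k)" by (metis prod_cases3)
  let ?h = "\<lambda>p. \<Sum>a\<in>UNIV. \<Sum>b\<in>UNIV. \<Sum>m\<in>UNIV. gmat p k m * c (a, b, m) * adjmat p a i * adjmat p b j"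
  have "?h \<in> polyfun"
    by (intro polyfun_intros polyfun_gmat polyfun_adjmat)
  moreover have "gdet p ^ 2 * act (gmat p) (hmat p) c t = ?h p" if "gdet p \<noteq> 0" for p
    using that unfolding t act_def hmat_def sum_idx by (simp add: field_simps power2_eq_square)
  ultimately show "\<exists>k. \<exists>h\<in>polyfun. \<forall>p. gdet p \<noteq> 0 \<longrightarrow> gdet p ^ k * act (gmat p) (hmat p) c t = h p"
    by (intro exI[of _ 2] bexI[of _ ?h]) auto
qed (rule polyfun_gdet)

lemma orbit_eq_image: "orbit c = (\<lambda>p. act (gmat p) (hmat p) c) ` {p. gdet p \<noteq> 0}"
  using mem_orbit_iff by auto

lemma polyfun_act: "(\<lambda>c. act g h c t) \<in> polyfun"
  unfolding act_def by (cases t) (auto intro!: polyfun_intros)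

lemma zariski_closed_vimage:
  assumes "zariski_closed K" "\<And>v. (\<lambda>p. \<phi> p v) \<in> polyfun"
  shows "zariski_closed {p. \<phi> p \<in> K}"
proof -
  obtain F where F: "F \<subseteq> polyfun" "K = {p. \<forall>f\<in>F. f p = 0}"
    using assms(1) unfolding zariski_closed_def by auto
  have "{p. \<phi> p \<in> K} = {p. \<forall>f\<in>(\<lambda>f p. f (\<phi> p)) ` F. f p = 0}"
    unfolding F(2) by auto
  moreover have "(\<lambda>f p. f (\<phi> p)) ` F \<subseteq> polyfun"
    using F(1) polyfun_compose assms(2) by blast
  ultimately show ?thesis unfolding zariski_closed_def by blast
qed

text \<open>A fixed group element acts by a polynomial map that preserves the orbit, so the preimage
  of the closure is a closed set containing the orbit.\<close>

lemma orbit_closure_invariant: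
  assumes "c \<in> orbit c'" "c' \<in> zariski closure_of (orbit r)"
  shows "c \<in> zariski closure_of (orbit r)"
proof -
  obtain p where p: "gdet p \<noteq> 0" "c = act (gmat p) (hmat p) c'"
    using assms(1) unfolding mem_orbit_iff by blast
  let ?K = "zariski closure_of (orbit r)"
  have "zariski_closed ?K" by (simp flip: closedin_zariski)
  then have "closedin zariski {d. act (gmat p) (hmat p) d \<in> ?K}"
    unfolding closedin_zariski by (rule zariski_closed_vimage) (rule polyfun_act)
  moreover have "orbit r \<subseteq> {d. act (gmat p) (hmat p) d \<in> ?K}"
  proof
    fix d assume "d \<in> orbit r"
    then have "act (gmat p) (hmat p) d \<in> orbit r"
      using p(1) orbit_trans mem_orbit_iff by blast
    then show "d \<in> {d. act (gmat p) (hmat p) d \<in> ?K}"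
      using closure_of_subset[of "orbit r" zariski] by auto
  qed
  ultimately have "?K \<subseteq> {d. act (gmat p) (hmat p) d \<in> ?K}"
    by (intro closure_of_minimal)
  then show ?thesis using assms(2) p(2) by auto
qed

section \<open>The variety of associative structures\<close>

lemma assoc_struc_iff: "assoc_struc c \<longleftrightarrow>
  (\<forall>i j k m. (\<Sum>l\<in>UNIV. c (i, j, l) * c (l, k, m)) = (\<Sum>l\<in>UNIV. c (j, k, l) * c (i, l, m)))"
proof
  assume L: "assoc_struc c"
  show "\<forall>i j k m. (\<Sum>l\<in>UNIV. c (i, j, l) * c (l, k, m)) = (\<Sum>l\<in>UNIV. c (j, k, l) * c (i, l, m))"
  proof (intro allI)
    fix i j k m
    let ?e = "\<lambda>i a. if a = i then 1 else 0 :: complex"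
    have e: "mult c (?e i) (?e j) = (\<lambda>k. c (i, j, k))" for i j
      by (rule ext) (rule mult_basis)
    have "mult c (mult c (?e i) (?e j)) (?e k) m = mult c (?e i) (mult c (?e j) (?e k)) m"
      using L unfolding assoc_struc_def by simp
    moreover have "mult c x (?e k) m = (\<Sum>l\<in>UNIV. x l * c (l, k, m))" for x
      by (cases k) (simp_all add: mult_def sum_idx)
    moreover have "mult c (?e i) x m = (\<Sum>l\<in>UNIV. x l * c (i, l, m))" for x
      by (cases i) (simp_all add: mult_def sum_idx)
    ultimately show "(\<Sum>l\<in>UNIV. c (i, j, l) * c (l, k, m)) = (\<Sum>l\<in>UNIV. c (j, k, l) * c (i, l, m))"
      unfolding e by simp
  qed
next
  assume R: "\<forall>i j k m. (\<Sum>l\<in>UNIV. c (i, j, l) * c (l, k, m)) = (\<Sum>l\<in>UNIV. c (j, k, l) * c (i, l, m))"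
  show "assoc_struc c"
    unfolding assoc_struc_def
  proof (intro allI ext)
    fix x y z m
    have "mult c (mult c x y) z m =
      (\<Sum>i\<in>UNIV. \<Sum>j\<in>UNIV. \<Sum>k\<in>UNIV. x i * y j * z k * (\<Sum>l\<in>UNIV. c (i, j, l) * c (l, k, m)))"
      unfolding mult_def sum_idx by (simp add: algebra_simps)
    also have "\<dots> = (\<Sum>i\<in>UNIV. \<Sum>j\<in>UNIV. \<Sum>k\<in>UNIV. x i * y j * z k * (\<Sum>l\<in>UNIV. c (j, k, l) * c (i, l, m)))"
      using R by simp
    also have "\<dots> = mult c x (mult c y z) m"
      unfolding mult_def sum_idx by (simp add: algebra_simps)
    finally show "mult c (mult c x y) z m = mult c x (mult c y z) m" .
  qed
qed

lemma orbit_subset_AssocVar: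
  assumes "c \<in> AssocVar"
  shows "orbit c \<subseteq> AssocVar"
proof
  fix c' assume c': "c' \<in> orbit c"
  obtain p where p: "gdet p \<noteq> 0" "c' = act (gmat p) (hmat p) c"
    using c' unfolding mem_orbit_iff by blast
  have "assoc_struc c'"
    using assms unfolding AssocVar_def assoc_struc_def p(2) by (simp add: mult_act app_gmat_hmat p(1))
  moreover have "even_struc c'"
    using assms unfolding AssocVar_def even_struc_def p(2) all_idx
    by (simp add: act_def sum_idx hmat_def)
  ultimately show "c' \<in> AssocVar" unfolding AssocVar_def by simp
qed

lemma topspace_XT [simp]: "topspace XT = AssocVar"
  unfolding XT_def by simp

lemma subtopology_XT: "Y \<subseteq> AssocVar \<Longrightarrow> subtopology XT Y = subtopology zariski Y"
  unfolding XT_def by (simp add: subtopology_subtopology Int_absorb1)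

lemma XT_closure_of_orbit:
  assumes "c \<in> AssocVar"
  shows "XT closure_of (orbit c) = AssocVar \<inter> zariski closure_of (orbit c)"
  unfolding XT_def closure_of_subtopology using orbit_subset_AssocVar[OF assms]
  by (simp add: Int_absorb1)

lemma irreducible_orbit:
  assumes "c \<in> AssocVar"
  shows "irreducible_in XT (orbit c)"
proof -
  obtain p where "gdet p \<noteq> 0" using gdet_nonzero_ex by blast
  then have "irreducible_in zariski (orbit c)"
    unfolding orbit_eq_image by (intro irreducible_rational_image rational_map_act)
  then show ?thesis
    unfolding XT_def irreducible_in_subtopology using orbit_subset_AssocVar[OF assms] by blast
qed

lemma krull_dim_orbit_closure_le:
  assumes "c \<in> AssocVar"
  shows "krull_dim (subtopology XT (XT closure_of (orbit c))) \<le> 5"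
proof -
  have eq: "subtopology XT (XT closure_of (orbit c)) = subtopology zariski (XT closure_of (orbit c))"
    by (rule subtopology_XT) (simp add: XT_closure_of_orbit[OF assms])
  have "n \<le> 5" if "chain_len (subtopology XT (XT closure_of (orbit c))) n" for n
    using chain_len_rational_closure[OF rational_map_act _ that[unfolded eq], of c]
    unfolding orbit_eq_image[symmetric] CARD_prm XT_closure_of_orbit[OF assms] by simp
  then have "enat n \<le> 5" if "chain_len (subtopology XT (XT closure_of (orbit c))) n" for n
    using that by (simp add: numeral_eq_enat)
  then show ?thesis
    unfolding krull_dim_def by (auto intro: Sup_least)
qed

text \<open>Nonvanishing of \<open>f\<close> gives a neighbourhood of the single point
  \<open>c\<^sub>0\<close>; composing \<open>f\<close> with a group element that carries
  \<open>c\<close> to \<open>c\<^sub>0\<close> gives one of any other point \<open>c\<close> of the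
  orbit.\<close>

lemma openin_XT_orbitI:
  assumes "f \<in> polyfun" "c\<^sub>0 \<in> orbit r" "f c\<^sub>0 \<noteq> 0" "r \<in> AssocVar"
    "\<And>c. c \<in> AssocVar \<Longrightarrow> f c \<noteq> 0 \<Longrightarrow> c \<in> orbit r"
  shows "openin XT (orbit r)"
proof (subst openin_subopen, intro ballI)
  fix c assume "c \<in> orbit r"
  then have "c\<^sub>0 \<in> orbit c" using assms(2) orbit_eqI by blast
  then obtain p where p: "gdet p \<noteq> 0" "c\<^sub>0 = act (gmat p) (hmat p) c"
    unfolding mem_orbit_iff by blast
  let ?f = "\<lambda>d. f (act (gmat p) (hmat p) d)"
  have "?f \<in> polyfun"
    by (rule polyfun_compose[OF assms(1) polyfun_act])
  then have "openin zariski (- {d. ?f d = 0})"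
    by (simp add: openin_zariski zariski_closed_zeros)
  then have "openin XT (- {d. ?f d = 0} \<inter> AssocVar)"
    unfolding XT_def by (auto simp: openin_subtopology)
  moreover have "c \<in> - {d. ?f d = 0} \<inter> AssocVar"
    using assms(3) p(2) \<open>c \<in> orbit r\<close> orbit_subset_AssocVar[OF assms(4)] by auto
  moreover have "- {d. ?f d = 0} \<inter> AssocVar \<subseteq> orbit r"
  proof
    fix d assume d: "d \<in> - {d. ?f d = 0} \<inter> AssocVar"
    have act: "act (gmat p) (hmat p) d \<in> orbit d" using p(1) mem_orbit_iff by blast
    then have "act (gmat p) (hmat p) d \<in> orbit r"
      using assms(5) d orbit_subset_AssocVar by blast
    then show "d \<in> orbit r" using act orbit_sym orbit_trans by blast
  qed
  ultimately show "\<exists>T. openin XT T \<and> c \<in> T \<and> T \<subseteq> orbit r" by blast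
qed

section \<open>Structure constants\<close>

text \<open>The 14 constants permitted by the grading: eight for the even part, \<open>l\<close> and
  \<open>r\<close> for the scalars by which e_1 and e_2 act on f_1 from the left and from the right,
  \<open>s\<close> for the square of f_1.\<close>

definition strc :: "complex \<Rightarrow> complex \<Rightarrow> complex \<Rightarrow> complex \<Rightarrow> complex \<Rightarrow> complex \<Rightarrow> complex \<Rightarrow> complex \<Rightarrow>
    complex \<Rightarrow> complex \<Rightarrow> complex \<Rightarrow> complex \<Rightarrow> complex \<Rightarrow> complex \<Rightarrow> struc" where
  "strc p q u v u' v' w z l\<^sub>1 l\<^sub>2 r\<^sub>1 r\<^sub>2 s\<^sub>1 s\<^sub>2 = (\<lambda>(i, j, k). case (i, j, k) of
     (E1, E1, E1) \<Rightarrow> p | (E1, E1, E2) \<Rightarrow> q | (E1, E2, E1) \<Rightarrow> u | (E1, E2, E2) \<Rightarrow> v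
   | (E2, E1, E1) \<Rightarrow> u' | (E2, E1, E2) \<Rightarrow> v' | (E2, E2, E1) \<Rightarrow> w | (E2, E2, E2) \<Rightarrow> z
   | (E1, F1, F1) \<Rightarrow> l\<^sub>1 | (E2, F1, F1) \<Rightarrow> l\<^sub>2 | (F1, E1, F1) \<Rightarrow> r\<^sub>1 | (F1, E2, F1) \<Rightarrow> r\<^sub>2
   | (F1, F1, E1) \<Rightarrow> s\<^sub>1 | (F1, F1, E2) \<Rightarrow> s\<^sub>2 | _ \<Rightarrow> 0)"

lemma even_struc_strc: "even_struc (strc p q u v u' v' w z l\<^sub>1 l\<^sub>2 r\<^sub>1 r\<^sub>2 s\<^sub>1 s\<^sub>2)"
  unfolding even_struc_def all_idx strc_def by simp

lemma even_struc_eq_strc: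
  assumes "even_struc c"
  shows "c = strc (c (E1, E1, E1)) (c (E1, E1, E2)) (c (E1, E2, E1)) (c (E1, E2, E2))
    (c (E2, E1, E1)) (c (E2, E1, E2)) (c (E2, E2, E1)) (c (E2, E2, E2))
    (c (E1, F1, F1)) (c (E2, F1, F1)) (c (F1, E1, F1)) (c (F1, E2, F1)) (c (F1, F1, E1)) (c (F1, F1, E2))"
    (is "c = ?s")
proof
  fix t :: "idx \<times> idx \<times> idx"
  obtain i j k where t: "t = (i, j, k)" by (metis prod_cases3)
  have "c (i, j, k) = 0" if "par k \<noteq> (par i + par j) mod 2"
    using assms that unfolding even_struc_def by blast
  then show "c t = ?s t"
    unfolding t strc_def by (cases i; cases j; cases k) simp_all
qed

lemma AssocVarE:
  assumes "c \<in> AssocVar"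
  obtains p q u v u' v' w z l\<^sub>1 l\<^sub>2 r\<^sub>1 r\<^sub>2 s\<^sub>1 s\<^sub>2 where "c = strc p q u v u' v' w z l\<^sub>1 l\<^sub>2 r\<^sub>1 r\<^sub>2 s\<^sub>1 s\<^sub>2"
  using assms even_struc_eq_strc unfolding AssocVar_def by blast

text \<open>Associativity on triples of basis vectors. A disjunction such as
  \<open>q = 0 \<or> u' = u\<close> is an equation \<open>q * u' = q * u\<close> with its common
  factor cancelled.\<close>

lemma strc_AssocVar_iff:
  "strc p q u v u' v' w z l\<^sub>1 l\<^sub>2 r\<^sub>1 r\<^sub>2 s\<^sub>1 s\<^sub>2 \<in> AssocVar \<longleftrightarrow>
   (q = 0 \<or> u' = u) \<and> (q = 0 \<or> v' = v) \<and> q * w = v * u \<and> p * v + q * z = u * q + v * v \<and>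
   p * l\<^sub>1 + q * l\<^sub>2 = l\<^sub>1 * l\<^sub>1 \<and> u * p + v * u' = u' * p + v' * u \<and> (q = 0 \<or> u = u') \<and>
   u * u + v * w = w * p + z * u \<and> u * v = w * q \<and> u * l\<^sub>1 + v * l\<^sub>2 = l\<^sub>2 * l\<^sub>1 \<and>
   l\<^sub>1 * s\<^sub>1 = s\<^sub>1 * p + s\<^sub>2 * u \<and> l\<^sub>1 * s\<^sub>2 = s\<^sub>1 * q + s\<^sub>2 * v \<and> v' * u' = q * w \<and>
   u' * q + v' * v' = p * v' + q * z \<and> (w = 0 \<or> v' = v) \<and> u' * v + v' * z = u * v' + v * z \<and>
   u' * l\<^sub>1 + v' * l\<^sub>2 = l\<^sub>1 * l\<^sub>2 \<and> w * p + z * u' = u' * u' + v' * w \<and> w * q = u' * v' \<and>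
   (w = 0 \<or> u = u') \<and> (w = 0 \<or> v = v') \<and> w * l\<^sub>1 + z * l\<^sub>2 = l\<^sub>2 * l\<^sub>2 \<and>
   l\<^sub>2 * s\<^sub>1 = s\<^sub>1 * u' + s\<^sub>2 * w \<and> l\<^sub>2 * s\<^sub>2 = s\<^sub>1 * v' + s\<^sub>2 * z \<and>
   r\<^sub>1 * r\<^sub>1 = p * r\<^sub>1 + q * r\<^sub>2 \<and> r\<^sub>1 * r\<^sub>2 = u * r\<^sub>1 + v * r\<^sub>2 \<and>
   (s\<^sub>1 = 0 \<or> r\<^sub>1 = l\<^sub>1) \<and> (s\<^sub>2 = 0 \<or> r\<^sub>1 = l\<^sub>1) \<and>
   r\<^sub>2 * r\<^sub>1 = u' * r\<^sub>1 + v' * r\<^sub>2 \<and> r\<^sub>2 * r\<^sub>2 = w * r\<^sub>1 + z * r\<^sub>2 \<and>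
   (s\<^sub>1 = 0 \<or> r\<^sub>2 = l\<^sub>2) \<and> (s\<^sub>2 = 0 \<or> r\<^sub>2 = l\<^sub>2) \<and>
   s\<^sub>1 * p + s\<^sub>2 * u' = r\<^sub>1 * s\<^sub>1 \<and> s\<^sub>1 * q + s\<^sub>2 * v' = r\<^sub>1 * s\<^sub>2 \<and>
   s\<^sub>1 * u + s\<^sub>2 * w = r\<^sub>2 * s\<^sub>1 \<and> s\<^sub>1 * v + s\<^sub>2 * z = r\<^sub>2 * s\<^sub>2 \<and> s\<^sub>1 * l\<^sub>1 + s\<^sub>2 * l\<^sub>2 = s\<^sub>1 * r\<^sub>1 + s\<^sub>2 * r\<^sub>2"
  (is "?L \<longleftrightarrow> ?R")
proof -
  have "?L \<longleftrightarrow> assoc_struc (strc p q u v u' v' w z l\<^sub>1 l\<^sub>2 r\<^sub>1 r\<^sub>2 s\<^sub>1 s\<^sub>2)"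
    by (simp add: AssocVar_def even_struc_strc)
  also have "\<dots> \<longleftrightarrow> ?R"
    unfolding assoc_struc_iff all_idx sum_idx by (simp add: strc_def)
  finally show ?thesis .
qed

lemma R_eq_strc:
  "R01 = strc 1 0 0 0 0 0 0 1 0 0 0 0 0 0"
  "R03 = strc 1 0 0 0 0 0 0 1 1 0 1 0 1 0"
  "R04 = strc 1 0 0 0 0 0 0 1 0 0 1 0 0 0"
  "R05 = strc 1 0 0 0 0 0 0 1 1 0 0 0 0 0"
  "R07 = strc 1 0 0 0 0 0 0 1 0 1 1 0 0 0"
  "R23 = strc 1 0 0 1 0 0 0 0 0 0 0 0 0 0"
  "R25 = strc 1 0 0 0 0 1 0 0 0 0 0 0 0 0"
  "R26 = strc 1 0 0 0 0 1 0 0 1 0 0 0 0 0"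
  "R29 = strc 1 0 0 1 0 0 0 0 0 0 1 0 0 0"
  "R31 = strc 1 0 0 0 0 1 0 0 0 0 1 0 0 0"
  "R32 = strc 1 0 0 1 0 0 0 0 1 0 0 0 0 0"
  "R33 = strc 1 0 0 0 0 1 0 0 1 0 1 0 0 0"
  "R36 = strc 1 0 0 1 0 0 0 0 1 0 1 0 0 0"
  unfolding R01_def R03_def R04_def R05_def R07_def R23_def R25_def R26_def R29_def R31_def
    R32_def R33_def R36_def sc_def strc_def
  by (auto simp: fun_eq_iff split: idx.split)

lemma Rlist_AssocVar: "r \<in> Rlist \<Longrightarrow> r \<in> AssocVar"
  unfolding Rlist_def R_eq_strc by (auto simp: strc_AssocVar_iff)

section \<open>Invariants of orbits\<close>

lemma gmat_even: "x F1 = 0 \<Longrightarrow> app (gmat p) x F1 = 0" "x F1 = 0 \<Longrightarrow> app (hmat p) x F1 = 0"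
  by (simp_all add: app_def sum_idx hmat_def)

lemma gmat_odd:
  "x E1 = 0 \<Longrightarrow> x E2 = 0 \<Longrightarrow> app (hmat p) x E1 = 0"
  "x E1 = 0 \<Longrightarrow> x E2 = 0 \<Longrightarrow> app (hmat p) x E2 = 0"
  by (simp_all add: app_def sum_idx hmat_def)

definition even_commutes :: "struc \<Rightarrow> bool" where
  "even_commutes c \<longleftrightarrow> (\<forall>x y. x F1 = 0 \<longrightarrow> y F1 = 0 \<longrightarrow> mult c x y = mult c y x)"

definition even_right_unital :: "struc \<Rightarrow> bool" where
  "even_right_unital c \<longleftrightarrow> (\<exists>y. y F1 = 0 \<and> (\<forall>x. x F1 = 0 \<longrightarrow> mult c x y = x))"

definition left_trivial :: "struc \<Rightarrow> bool" where
  "left_trivial c \<longleftrightarrow> (\<forall>x y. x F1 = 0 \<longrightarrow> y E1 = 0 \<longrightarrow> y E2 = 0 \<longrightarrow> mult c x y = (\<lambda>_. 0))"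

definition right_trivial :: "struc \<Rightarrow> bool" where
  "right_trivial c \<longleftrightarrow> (\<forall>x y. x F1 = 0 \<longrightarrow> y E1 = 0 \<longrightarrow> y E2 = 0 \<longrightarrow> mult c y x = (\<lambda>_. 0))"

definition odd_commutes :: "struc \<Rightarrow> bool" where
  "odd_commutes c \<longleftrightarrow> (\<forall>x y. x F1 = 0 \<longrightarrow> y E1 = 0 \<longrightarrow> y E2 = 0 \<longrightarrow> mult c x y = mult c y x)"

text \<open>Commutativity of the even part singles out the orbits over \<complex> \<times>
  \<complex>, a right unit separates the two noncommutative even parts, triviality of the actions
  separates the remaining cases except \<open>R03\<close> and \<open>R07\<close>, and these differ
  in \<open>odd_commutes\<close>.\<close>

definition invariants :: "struc \<Rightarrow> bool \<times> bool \<times> bool \<times> bool \<times> bool" where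
  "invariants c = (even_commutes c, even_right_unital c, left_trivial c, right_trivial c, odd_commutes c)"

lemma invariants_orbit:
  assumes "c' \<in> orbit c"
  shows "invariants c' = invariants c"
proof -
  have zero: "app g (\<lambda>_. 0) = (\<lambda>_. 0)" for g by (simp add: app_def)
  have *: "(even_commutes c \<longrightarrow> even_commutes c') \<and> (even_right_unital c \<longrightarrow> even_right_unital c') \<and>
    (left_trivial c \<longrightarrow> left_trivial c') \<and> (right_trivial c \<longrightarrow> right_trivial c') \<and>
    (odd_commutes c \<longrightarrow> odd_commutes c')" if orb: "c' \<in> orbit c" for c c'
  proof -
    obtain p where p: "gdet p \<noteq> 0" "\<And>x y. mult c' x y = app (gmat p) (mult c (app (hmat p) x) (app (hmat p) y))"
      using orbitE[OF orb] by blast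
    have "even_right_unital c'" if unital: "even_right_unital c"
    proof -
      obtain y where y: "y F1 = 0" "\<forall>x. x F1 = 0 \<longrightarrow> mult c x y = x"
        using unital unfolding even_right_unital_def by auto
      then have "mult c' x (app (gmat p) y) = x" if "x F1 = 0" for x
        using that by (simp add: p app_gmat_hmat gmat_even)
      then show ?thesis unfolding even_right_unital_def using gmat_even(1)[of y p] y(1) by auto
    qed
    moreover have "odd_commutes c'" if "odd_commutes c"
      unfolding odd_commutes_def p(2)
      by (intro allI impI arg_cong[where f = "app (gmat p)"]
          that[unfolded odd_commutes_def, rule_format] gmat_even gmat_odd)
    moreover have "even_commutes c'" if "even_commutes c"
      unfolding even_commutes_def p(2)
      by (intro allI impI arg_cong[where f = "app (gmat p)"]
          that[unfolded even_commutes_def, rule_format] gmat_even)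
    ultimately show ?thesis
      unfolding left_trivial_def right_trivial_def by (simp add: p(2) gmat_even gmat_odd zero)
  qed
  show ?thesis
    unfolding invariants_def using *[OF assms] *[OF orbit_sym[OF assms]] by blast
qed

lemma even_commutes_strc:
  "even_commutes (strc p q u v u' v' w z l\<^sub>1 l\<^sub>2 r\<^sub>1 r\<^sub>2 s\<^sub>1 s\<^sub>2) \<longleftrightarrow> u = u' \<and> v = v'" (is "even_commutes ?c \<longleftrightarrow> _")
proof
  assume "even_commutes ?c"
  then have "mult ?c (\<lambda>a. if a = E1 then 1 else 0) (\<lambda>a. if a = E2 then 1 else 0) k
      = mult ?c (\<lambda>a. if a = E2 then 1 else 0) (\<lambda>a. if a = E1 then 1 else 0) k" for k
    unfolding even_commutes_def by simp
  from this[of E1] this[of E2] show "u = u' \<and> v = v'"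
    unfolding mult_basis by (simp add: strc_def)
next
  assume "u = u' \<and> v = v'"
  then show "even_commutes ?c"
    unfolding even_commutes_def mult_def sum_idx strc_def by (auto simp: fun_eq_iff split: idx.split)
qed

lemma mult_strc_even_odd:
  assumes "x F1 = 0" "y E1 = 0" "y E2 = 0"
  shows "mult (strc p q u v u' v' w z l\<^sub>1 l\<^sub>2 r\<^sub>1 r\<^sub>2 s\<^sub>1 s\<^sub>2) x y k
      = (if k = F1 then (x E1 * l\<^sub>1 + x E2 * l\<^sub>2) * y F1 else 0)"
    and "mult (strc p q u v u' v' w z l\<^sub>1 l\<^sub>2 r\<^sub>1 r\<^sub>2 s\<^sub>1 s\<^sub>2) y x k
      = (if k = F1 then (x E1 * r\<^sub>1 + x E2 * r\<^sub>2) * y F1 else 0)"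
  using assms by (cases k; simp add: mult_def sum_idx strc_def algebra_simps)+

lemma odd_strc:
  "left_trivial (strc p q u v u' v' w z l\<^sub>1 l\<^sub>2 r\<^sub>1 r\<^sub>2 s\<^sub>1 s\<^sub>2) \<longleftrightarrow> l\<^sub>1 = 0 \<and> l\<^sub>2 = 0" (is ?A)
  "right_trivial (strc p q u v u' v' w z l\<^sub>1 l\<^sub>2 r\<^sub>1 r\<^sub>2 s\<^sub>1 s\<^sub>2) \<longleftrightarrow> r\<^sub>1 = 0 \<and> r\<^sub>2 = 0" (is ?B)
  "odd_commutes (strc p q u v u' v' w z l\<^sub>1 l\<^sub>2 r\<^sub>1 r\<^sub>2 s\<^sub>1 s\<^sub>2) \<longleftrightarrow> l\<^sub>1 = r\<^sub>1 \<and> l\<^sub>2 = r\<^sub>2" (is ?C)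
proof -
  let ?c = "strc p q u v u' v' w z l\<^sub>1 l\<^sub>2 r\<^sub>1 r\<^sub>2 s\<^sub>1 s\<^sub>2"
  let ?e = "\<lambda>i a. if a = i then 1 else 0 :: complex"
  show ?A
  proof
    assume L: "left_trivial ?c"
    have "mult ?c (?e E1) (?e F1) F1 = 0" "mult ?c (?e E2) (?e F1) F1 = 0"
      by (subst L[unfolded left_trivial_def, rule_format]; simp)+
    then show "l\<^sub>1 = 0 \<and> l\<^sub>2 = 0" unfolding mult_basis by (simp add: strc_def)
  qed (unfold left_trivial_def, intro allI impI ext, simp add: mult_strc_even_odd)
  show ?B
  proof
    assume L: "right_trivial ?c"
    have "mult ?c (?e F1) (?e E1) F1 = 0" "mult ?c (?e F1) (?e E2) F1 = 0"
      by (subst L[unfolded right_trivial_def, rule_format]; simp)+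
    then show "r\<^sub>1 = 0 \<and> r\<^sub>2 = 0" unfolding mult_basis by (simp add: strc_def)
  qed (unfold right_trivial_def, intro allI impI ext, simp add: mult_strc_even_odd)
  show ?C
  proof
    assume L: "odd_commutes ?c"
    have "mult ?c (?e E1) (?e F1) F1 = mult ?c (?e F1) (?e E1) F1"
        "mult ?c (?e E2) (?e F1) F1 = mult ?c (?e F1) (?e E2) F1"
      by (subst L[unfolded odd_commutes_def, rule_format]; simp)+
    then show "l\<^sub>1 = r\<^sub>1 \<and> l\<^sub>2 = r\<^sub>2" unfolding mult_basis by (simp add: strc_def)
  qed (unfold odd_commutes_def, intro allI impI ext, simp add: mult_strc_even_odd)
qed

lemma even_right_unital_strc:
  "even_right_unital (strc 1 0 0 0 0 0 0 1 l\<^sub>1 l\<^sub>2 r\<^sub>1 r\<^sub>2 s\<^sub>1 s\<^sub>2)" (is ?A)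
  "even_right_unital (strc 1 0 0 0 0 1 0 0 l\<^sub>1 l\<^sub>2 r\<^sub>1 r\<^sub>2 s\<^sub>1 s\<^sub>2)" (is ?B)
  "\<not> even_right_unital (strc 1 0 0 1 0 0 0 0 l\<^sub>1 l\<^sub>2 r\<^sub>1 r\<^sub>2 s\<^sub>1 s\<^sub>2)" (is ?C)
proof -
  show ?A
    unfolding even_right_unital_def
    by (rule exI[of _ "\<lambda>i. if i = F1 then 0 else 1"])
      (auto simp: mult_def sum_idx strc_def fun_eq_iff split: idx.split)
  show ?B
    unfolding even_right_unital_def
    by (rule exI[of _ "\<lambda>i. if i = E1 then 1 else 0"])
      (auto simp: mult_def sum_idx strc_def fun_eq_iff split: idx.split)
  show ?C
  proof
    assume "even_right_unital (strc 1 0 0 1 0 0 0 0 l\<^sub>1 l\<^sub>2 r\<^sub>1 r\<^sub>2 s\<^sub>1 s\<^sub>2)"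
    then obtain y where "y F1 = 0" "\<And>x. x F1 = 0 \<Longrightarrow> mult (strc 1 0 0 1 0 0 0 0 l\<^sub>1 l\<^sub>2 r\<^sub>1 r\<^sub>2 s\<^sub>1 s\<^sub>2) x y = x"
      unfolding even_right_unital_def by blast
    from fun_cong[OF this(2)[of "\<lambda>i. if i = E2 then 1 else 0"], of E2] this(1)
    show False by (simp add: mult_def sum_idx strc_def)
  qed
qed

text \<open>Thirteen different values on a set of at most thirteen elements yield both claims at
  once.\<close>

lemma inj_on_invariants: "inj_on invariants Rlist" and card_Rlist: "card Rlist = 13"
proof -
  note inv = R_eq_strc invariants_def even_commutes_strc odd_strc even_right_unital_strc
  have "card (invariants ` Rlist) = 13"
    unfolding Rlist_def by (simp add: inv)
  moreover have "card Rlist \<le> 13"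
    using card_length[of "[R01, R03, R04, R05, R07, R23, R25, R26, R29, R31, R32, R33, R36]"]
    unfolding Rlist_def by simp
  moreover have "finite Rlist" unfolding Rlist_def by simp
  ultimately show "card Rlist = 13" "inj_on invariants Rlist"
    using card_image_le[of Rlist invariants] eq_card_imp_inj_on[of Rlist invariants] by auto
qed

lemma inj_on_orbit: "inj_on orbit Rlist"
  using inj_on_invariants invariants_orbit orbit_refl unfolding inj_on_def by metis

section \<open>Structures whose even part is generated by one element\<close>

definition fam_val :: "complex \<Rightarrow> complex \<Rightarrow> complex \<Rightarrow> complex \<Rightarrow> nat \<Rightarrow> complex" where
  "fam_val p q a b k = (if k = 0 then 0 else if k = 1 then p + q * a else p + q * b)"

text \<open>The ratio of the values of character \<open>k\<close> at e_2 and e_1, which stays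
  polynomial where the value at e_1 vanishes. For \<open>k = 0\<close> the default \<open>b\<close>
  is multiplied by the value 0.\<close>

definition fam_slope :: "complex \<Rightarrow> complex \<Rightarrow> nat \<Rightarrow> complex" where
  "fam_slope a b k = (if k = 1 then a else b)"

text \<open>In \<open>\<complex> \<times> \<complex>\<close> take \<open>e\<^sub>1 = (A, B)\<close> and \<open>e\<^sub>2 = (A a, B b)\<close> with \<open>A = p + q a\<close>, \<open>B = p + q b\<close>,
  so that \<open>e\<^sub>1 e\<^sub>1 = p e\<^sub>1 + q e\<^sub>2\<close>. The structure constants are polynomial in \<open>p, q, a, b\<close>, which
  makes sense of degenerate parameters. The even part acts on \<open>f\<^sub>1\<close> from the left and from the
  right by the characters number \<open>k\<close> and \<open>l\<close>, where \<open>0\<close> stands for the zero map, \<open>1\<close> and \<open>2\<close> for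
  the projections; the square of \<open>f\<^sub>1\<close> is a multiple of the first idempotent.\<close>

definition fam :: "complex \<Rightarrow> complex \<Rightarrow> complex \<Rightarrow> complex \<Rightarrow> nat \<Rightarrow> nat \<Rightarrow> complex \<Rightarrow> struc" where
  "fam p q a b k l g = strc p q (- q * a * b) (p + q * (a + b)) (- q * a * b) (p + q * (a + b))
     (- a * b * (p + q * (a + b))) ((a + b) * (p + q * (a + b)) - q * a * b)
     (fam_val p q a b k) (fam_val p q a b k * fam_slope a b k)
     (fam_val p q a b l) (fam_val p q a b l * fam_slope a b l) (- g * b) g"

lemma fam_AssocVar: "fam p q a b 1 1 g \<in> AssocVar"
  unfolding fam_def strc_AssocVar_iff fam_val_def fam_slope_def by (simp add: algebra_simps)

text \<open>Exchanging the two idempotents exchanges the roots and the characters 1 and 2. This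
  reduces the nine pairs of characters to five.\<close>

lemma fam_swap:
  "fam p q a b 0 2 0 = fam p q b a 0 1 0" "fam p q a b 2 0 0 = fam p q b a 1 0 0"
  "fam p q a b 1 2 0 = fam p q b a 2 1 0" "fam p q a b 2 2 0 = fam p q b a 1 1 0"
  unfolding fam_def fam_val_def fam_slope_def by (simp_all add: algebra_simps)

text \<open>The last hypothesis compares squares of f_1: with A = p + q a and B = p + q b, the
  vector -g b e_1 + g e_2 becomes (g A (a - b), 0) in \<complex> \<times> \<complex>, while t f_1
  has square t t s times the first idempotent.\<close>

lemma fam_orbitI:
  assumes "p + q * a \<noteq> 0" "p + q * b \<noteq> 0" "a \<noteq> b" "t \<noteq> 0"
    "r = strc 1 0 0 0 0 0 0 1 l\<^sub>1 l\<^sub>2 r\<^sub>1 r\<^sub>2 s 0"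
    "fam_val p q a b k = (p + q * a) * l\<^sub>1 + (p + q * b) * l\<^sub>2"
    "fam_val p q a b k * fam_slope a b k = (p + q * a) * a * l\<^sub>1 + (p + q * b) * b * l\<^sub>2"
    "fam_val p q a b l = (p + q * a) * r\<^sub>1 + (p + q * b) * r\<^sub>2"
    "fam_val p q a b l * fam_slope a b l = (p + q * a) * a * r\<^sub>1 + (p + q * b) * b * r\<^sub>2"
    "t * t * s = g * (p + q * a) * (a - b)"
  shows "fam p q a b k l g \<in> orbit r"
proof (rule orbit_sym)
  \<comment> \<open>The columns are the images (A, B) of e_1 and (A a, B b) of e_2; f_1 is scaled by
    \<open>t\<close>.\<close>
  let ?p = "\<lambda>x. case x of P11 \<Rightarrow> p + q * a | P12 \<Rightarrow> (p + q * a) * a | P21 \<Rightarrow> p + q * b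
    | P22 \<Rightarrow> (p + q * b) * b | PF \<Rightarrow> t"
  show "r \<in> orbit (fam p q a b k l g)"
  proof (rule orbit_basisI)
    have "gdet ?p = t * ((p + q * a) * (p + q * b) * (b - a))"
      by (simp add: gdet_def algebra_simps)
    then show "gdet ?p \<noteq> 0" using assms(1-4) by simp
    fix i j m
    show "(\<Sum>x\<in>UNIV. \<Sum>y\<in>UNIV. gmat ?p x i * gmat ?p y j * r (x, y, m))
        = (\<Sum>n\<in>UNIV. gmat ?p m n * fam p q a b k l g (i, j, n))"
      unfolding assms(5) fam_def assms(7,9) unfolding assms(6,8) sum_idx
      by (cases i; cases j; cases m) (simp_all add: strc_def assms(10), simp_all add: algebra_simps)
  qed
qed

lemma fam_generic:
  assumes "p + q * a \<noteq> 0" "p + q * b \<noteq> 0" "a \<noteq> b"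
  shows "fam p q a b 0 0 0 \<in> orbit R01" "fam p q a b 0 1 0 \<in> orbit R04"
    "fam p q a b 1 0 0 \<in> orbit R05" "fam p q a b 2 1 0 \<in> orbit R07"
    "g \<noteq> 0 \<Longrightarrow> fam p q a b 1 1 g \<in> orbit R03"
proof -
  show "fam p q a b 0 0 0 \<in> orbit R01" "fam p q a b 0 1 0 \<in> orbit R04"
    "fam p q a b 1 0 0 \<in> orbit R05" "fam p q a b 2 1 0 \<in> orbit R07"
    by (rule fam_orbitI[OF assms, where t = 1, OF _ R_eq_strc(1)]
        fam_orbitI[OF assms, where t = 1, OF _ R_eq_strc(3)]
        fam_orbitI[OF assms, where t = 1, OF _ R_eq_strc(4)]
        fam_orbitI[OF assms, where t = 1, OF _ R_eq_strc(5)];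
        simp add: fam_val_def fam_slope_def)+
  assume "g \<noteq> 0"
  then show "fam p q a b 1 1 g \<in> orbit R03"
    using assms
    by (intro fam_orbitI[OF assms, where t = "csqrt (g * (p + q * a) * (a - b))", OF _ R_eq_strc(2)])
      (simp_all add: fam_val_def fam_slope_def power2_eq_square [symmetric])
qed

lemma quadratic_roots:
  fixes x y :: complex
  obtains a b where "a + b = x" "a * b = y"
proof -
  let ?d = "csqrt (x\<^sup>2 - 4 * y)"
  have "(x + ?d) / 2 + (x - ?d) / 2 = x" by (simp flip: add_divide_distrib)
  moreover have "(x + ?d) / 2 * ((x - ?d) / 2) = (x\<^sup>2 - ?d\<^sup>2) / 4"
    by (simp add: power2_eq_square algebra_simps)
  then have "(x + ?d) / 2 * ((x - ?d) / 2) = y" by simp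
  ultimately show ?thesis using that by blast
qed

text \<open>As \<open>q\<close> is nonzero, e_2 is a combination of e_1 and its square, so the even
  part is determined by \<open>p\<close>, \<open>q\<close>, \<open>u\<close>, \<open>v\<close>, and
  the actions on f_1 by the scalars of e_1.\<close>

lemma fam_exists:
  assumes "c \<in> AssocVar" "c (E1, E1, E2) \<noteq> 0"
  obtains p q a b k l g where "c = fam p q a b k l g" "k \<le> 2" "l \<le> 2" "g = 0 \<or> k = 1 \<and> l = 1" "q \<noteq> 0"
proof -
  obtain p q u v u' v' w z l\<^sub>1 l\<^sub>2 r\<^sub>1 r\<^sub>2 s\<^sub>1 s\<^sub>2
    where c: "c = strc p q u v u' v' w z l\<^sub>1 l\<^sub>2 r\<^sub>1 r\<^sub>2 s\<^sub>1 s\<^sub>2" using AssocVarE[OF assms(1)] by blast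
  have q: "q \<noteq> 0" using assms(2) by (simp add: c strc_def)
  note eqs = assms(1)[unfolded c strc_AssocVar_iff]
  have comm: "u' = u" "v' = v" using eqs q by blast+
  have "q * w = v * u" "p * v + q * z = u * q + v * v"
    "p * l\<^sub>1 + q * l\<^sub>2 = l\<^sub>1 * l\<^sub>1" "r\<^sub>1 * r\<^sub>1 = p * r\<^sub>1 + q * r\<^sub>2"
    using eqs by blast+
  then have wz: "w = v * u / q" "z = (u * q + v * v - p * v) / q"
    and l2: "l\<^sub>2 = (l\<^sub>1 * l\<^sub>1 - p * l\<^sub>1) / q" and r2: "r\<^sub>2 = (r\<^sub>1 * r\<^sub>1 - p * r\<^sub>1) / q"
    using q by (simp_all add: eq_divide_eq algebra_simps)
  have l12: "u * l\<^sub>1 + v * l\<^sub>2 = l\<^sub>2 * l\<^sub>1" and r12: "r\<^sub>1 * r\<^sub>2 = u * r\<^sub>1 + v * r\<^sub>2"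
    and s_eqs: "l\<^sub>1 * s\<^sub>1 = s\<^sub>1 * p + s\<^sub>2 * u" "l\<^sub>1 * s\<^sub>2 = s\<^sub>1 * q + s\<^sub>2 * v"
    using eqs by blast+
  have lr: "s\<^sub>1 \<noteq> 0 \<or> s\<^sub>2 \<noteq> 0 \<Longrightarrow> r\<^sub>1 = l\<^sub>1" using eqs by blast
  obtain a b where ab: "a + b = (v - p) / q" "a * b = - u / q"
    using quadratic_roots by metis
  have uv: "v = p + q * (a + b)" "u = - q * a * b" using ab q by (simp_all add: field_simps)
  \<comment> \<open>With A = p + q a and B = p + q b, the relation for e_1 e_2 makes a scalar
    \<open>x\<close> of e_1 a root of x (x - A) (x - B).\<close>
  have root: "x = 0 \<or> x = p + q * a \<or> x = p + q * b" if "u * x + v * ((x * x - p * x) / q) = (x * x - p * x) / q * x" for x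
  proof -
    define y where "y = (x * x - p * x) / q"
    have y: "x * x - p * x = q * y" unfolding y_def using q by simp
    have "q * u * x + v * (x * x - p * x) - (x * x - p * x) * x = q * (u * x + v * y - y * x)"
      unfolding y by (simp add: algebra_simps)
    then have "q * u * x + v * (x * x - p * x) - (x * x - p * x) * x = 0"
      using that unfolding y_def by simp
    then have "x * ((x - (p + q * a)) * (x - (p + q * b))) = 0"
      unfolding uv by (simp add: algebra_simps)
    then show ?thesis by auto
  qed
  have lroot: "l\<^sub>1 = 0 \<or> l\<^sub>1 = p + q * a \<or> l\<^sub>1 = p + q * b" using root l12 unfolding l2 by blast
  have rroot: "r\<^sub>1 = 0 \<or> r\<^sub>1 = p + q * a \<or> r\<^sub>1 = p + q * b" using root r12 unfolding r2 by (metis mult.commute)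
  have val: "\<exists>k\<le>2. x = fam_val p q a' b' k \<and> (x * x - p * x) / q = fam_val p q a' b' k * fam_slope a' b' k"
    if "x = 0 \<or> x = p + q * a' \<or> x = p + q * b'" for x a' b'
    using that
  proof (elim disjE)
    assume "x = 0"
    then show ?thesis by (intro exI[of _ 0]) (simp add: fam_val_def)
  next
    assume "x = p + q * a'"
    then show ?thesis using q by (intro exI[of _ 1]) (simp add: fam_val_def fam_slope_def field_simps)
  next
    assume "x = p + q * b'"
    then show ?thesis using q by (intro exI[of _ 2]) (simp add: fam_val_def fam_slope_def field_simps)
  qed
  \<comment> \<open>Stated for both orders of the roots, since a nonzero square of f_1 dictates
    which of them comes first.\<close>
  have even_part: "c = strc p q (- q * a' * b') (p + q * (a' + b')) (- q * a' * b') (p + q * (a' + b'))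
     (- a' * b' * (p + q * (a' + b'))) ((a' + b') * (p + q * (a' + b')) - q * a' * b') l\<^sub>1 l\<^sub>2 r\<^sub>1 r\<^sub>2 s\<^sub>1 s\<^sub>2"
    if "a' + b' = a + b" "a' * b' = a * b" for a' b'
  proof -
    have "u = - (q * (a' * b'))" "v = p + q * (a' + b')"
      unfolding uv that by simp_all
    moreover from this have "w = - (a' * b' * (p + q * (a' + b')))"
        "z = (a' + b') * (p + q * (a' + b')) - q * (a' * b')"
      unfolding wz using q by (simp_all add: field_simps)
    ultimately show ?thesis
      unfolding c comm by (simp add: mult.assoc)
  qed
  show ?thesis
  proof (cases "s\<^sub>2 = 0")
    case True
    then have "s\<^sub>1 = 0" using s_eqs(2) q by simp
    moreover obtain k where k: "k \<le> 2" "l\<^sub>1 = fam_val p q a b k" "l\<^sub>2 = fam_val p q a b k * fam_slope a b k"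
      using val[OF lroot] l2 by metis
    moreover obtain l where l: "l \<le> 2" "r\<^sub>1 = fam_val p q a b l" "r\<^sub>2 = fam_val p q a b l * fam_slope a b l"
      using val[OF rroot] r2 by metis
    ultimately have "c = fam p q a b k l 0"
      unfolding even_part[OF refl refl] fam_def using True by simp
    then show ?thesis using that k(1) l(1) q by blast
  next
    case False
    have s1: "s\<^sub>1 = s\<^sub>2 * (l\<^sub>1 - v) / q" using s_eqs(2) q by (simp add: field_simps)
    \<comment> \<open>The value 0 is no exception: the equations for the square of f_1 then give A B
      = 0, so that 0 is itself one of A and B.\<close>
    have "l\<^sub>1 = p + q * a \<or> l\<^sub>1 = p + q * b"
    proof (cases "l\<^sub>1 = 0")
      case True
      then have "s\<^sub>2 * (- v * p + u * q) = 0"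
        using s_eqs(1) q unfolding s1 by (auto simp: field_simps)
      then have "- v * p + u * q = 0"
        using False mult_eq_0_iff by blast
      moreover have "(p + q * a) * (p + q * b) = - (- v * p + u * q)"
        unfolding uv by (simp add: algebra_simps)
      ultimately have "(p + q * a) * (p + q * b) = 0" by simp
      then show ?thesis using True by auto
    qed (use lroot in auto)
    then obtain a' b' where ab': "l\<^sub>1 = p + q * a'" "a' + b' = a + b" "a' * b' = a * b"
      by (metis add.commute mult.commute)
    have "l\<^sub>2 = (p + q * a') * a'" unfolding l2 ab'(1) using q by (simp add: field_simps)
    moreover have "r\<^sub>1 = l\<^sub>1" "r\<^sub>2 = l\<^sub>2" using lr False unfolding l2 r2 by auto
    moreover have "s\<^sub>1 = - s\<^sub>2 * b'"
      unfolding s1 ab'(1) uv(1) ab'(2)[symmetric] using q by (simp add: field_simps)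
    ultimately have "c = fam p q a' b' 1 1 s\<^sub>2"
      unfolding even_part[OF ab'(2,3)] fam_def using ab'(1) by (simp add: fam_val_def fam_slope_def)
    then show ?thesis using that[of p q a' b' 1 1 s\<^sub>2] q by simp
  qed
qed

lemma polyfun_strc:
  assumes "p \<in> polyfun" "q \<in> polyfun" "u \<in> polyfun" "v \<in> polyfun" "u' \<in> polyfun" "v' \<in> polyfun"
    "w \<in> polyfun" "z \<in> polyfun" "l\<^sub>1 \<in> polyfun" "l\<^sub>2 \<in> polyfun" "r\<^sub>1 \<in> polyfun" "r\<^sub>2 \<in> polyfun"
    "s\<^sub>1 \<in> polyfun" "s\<^sub>2 \<in> polyfun"
  shows "(\<lambda>x. strc (p x) (q x) (u x) (v x) (u' x) (v' x) (w x) (z x) (l\<^sub>1 x) (l\<^sub>2 x) (r\<^sub>1 x) (r\<^sub>2 x)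
    (s\<^sub>1 x) (s\<^sub>2 x) t) \<in> polyfun"
proof -
  obtain i j k where "t = (i, j, k)" by (metis prod_cases3)
  then show ?thesis
    unfolding strc_def using assms by (cases i; cases j; cases k) (simp_all add: pconst)
qed

lemma polyfun_fam:
  assumes "p \<in> polyfun" "q \<in> polyfun" "a \<in> polyfun" "b \<in> polyfun" "g \<in> polyfun"
  shows "(\<lambda>x. fam (p x) (q x) (a x) (b x) k l (g x) t) \<in> polyfun"
proof -
  have "(\<lambda>x. fam_val (p x) (q x) (a x) (b x) k) \<in> polyfun" "(\<lambda>x. fam_slope (a x) (b x) k) \<in> polyfun" for k
    unfolding fam_val_def fam_slope_def using assms
    by (cases "k = 0"; cases "k = 1"; simp add: polyfun_intros)+
  then show ?thesis
    unfolding fam_def using assms by (intro polyfun_strc polyfun_intros)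
qed

text \<open>The factor \<open>G\<close>, which is 0 or 1 in the applications, switches the parameter
  \<open>g\<close> off or on, so that families with and without a square of f_1 are treated
  together.\<close>

lemma fam_closure:
  assumes "\<And>p q a b g. p + q * a \<noteq> 0 \<Longrightarrow> p + q * b \<noteq> 0 \<Longrightarrow> a \<noteq> b \<Longrightarrow> g \<noteq> 0 \<Longrightarrow>
      fam p q a b k l (G * g) \<in> orbit r"
  shows "fam p q a b k l (G * g) \<in> zariski closure_of (orbit r)"
proof -
  define \<phi> where "\<phi> x = fam (x P11) (x P12) (x P21) (x P22) k l (G * x PF)" for x
  define D where "D x = (x P11 + x P12 * x P21) * (x P11 + x P12 * x P22) * (x P21 - x P22) * x PF" for x :: "prm \<Rightarrow> complex"
  have "zariski_closed (zariski closure_of (orbit r))"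
    by (simp flip: closedin_zariski)
  moreover have "(\<lambda>x. \<phi> x t) \<in> polyfun" for t
    unfolding \<phi>_def by (intro polyfun_fam polyfun_intros)
  moreover have "D \<in> polyfun"
    unfolding D_def[abs_def] by (intro polyfun_intros)
  moreover have "D (\<lambda>x. if x = P12 \<or> x = P21 then 0 else 1) \<noteq> 0"
    by (simp add: D_def)
  moreover have "\<phi> x \<in> zariski closure_of (orbit r)" if "D x \<noteq> 0" for x
  proof -
    have "\<phi> x \<in> orbit r"
      unfolding \<phi>_def using that by (intro assms) (auto simp: D_def)
    then show ?thesis
      using closure_of_subset[of "orbit r" zariski] by auto
  qed
  ultimately have "\<phi> x \<in> zariski closure_of (orbit r)" for x
    by (rule zariski_closed_contains_image[where \<phi> = \<phi> and D = D])
  from this[of "\<lambda>x. case x of P11 \<Rightarrow> p | P12 \<Rightarrow> q | P21 \<Rightarrow> a | P22 \<Rightarrow> b | PF \<Rightarrow> g"]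
  show ?thesis by (simp add: \<phi>_def)
qed

lemma fam_in_closure:
  "fam p q a b 0 0 0 \<in> zariski closure_of (orbit R01)"
  "fam p q a b 0 1 0 \<in> zariski closure_of (orbit R04)"
  "fam p q a b 1 0 0 \<in> zariski closure_of (orbit R05)"
  "fam p q a b 2 1 0 \<in> zariski closure_of (orbit R07)"
  "fam p q a b 1 1 g \<in> zariski closure_of (orbit R03)"
  using fam_closure[of 0 0 0 R01 p q a b 1] fam_closure[of 0 1 0 R04 p q a b 1]
    fam_closure[of 1 0 0 R05 p q a b 1] fam_closure[of 2 1 0 R07 p q a b 1]
    fam_closure[of 1 1 1 R03 p q a b g] fam_generic
  by simp_all

section \<open>Structures whose even part has product \<open>\<phi>(x) y\<close> or \<open>\<phi>(y) x\<close>\<close>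

text \<open>Here \<open>\<phi> = (p, z)\<close> in coordinates, and the left and right action on \<open>f\<^sub>1\<close> are
  \<open>k \<phi>\<close> and \<open>l \<phi>\<close>.\<close>

definition Ltype :: "complex \<Rightarrow> complex \<Rightarrow> complex \<Rightarrow> complex \<Rightarrow> struc" where
  "Ltype p z k l = strc p 0 0 p z 0 0 z (k * p) (k * z) (l * p) (l * z) 0 0"

definition Rtype :: "complex \<Rightarrow> complex \<Rightarrow> complex \<Rightarrow> complex \<Rightarrow> struc" where
  "Rtype p z k l = strc p 0 z 0 0 p 0 z (k * p) (k * z) (l * p) (l * z) 0 0"

lemma R_eq_type:
  "R23 = Ltype 1 0 0 0" "R32 = Ltype 1 0 1 0" "R29 = Ltype 1 0 0 1" "R36 = Ltype 1 0 1 1"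
  "R25 = Rtype 1 0 0 0" "R26 = Rtype 1 0 1 0" "R31 = Rtype 1 0 0 1" "R33 = Rtype 1 0 1 1"
  unfolding R_eq_strc Ltype_def Rtype_def by simp_all

lemma type_orbit:
  assumes "p \<noteq> 0 \<or> z \<noteq> 0"
  shows "Ltype p z k l \<in> orbit (Ltype 1 0 k l)" "Rtype p z k l \<in> orbit (Rtype 1 0 k l)"
proof -
  \<comment> \<open>The first new coordinate is \<phi> itself; the second is an old coordinate
    independent of it.\<close>
  let ?p = "\<lambda>x. case x of P11 \<Rightarrow> p | P12 \<Rightarrow> z | P21 \<Rightarrow> if p = 0 then 1 else 0
    | P22 \<Rightarrow> if p = 0 then 0 else 1 | PF \<Rightarrow> 1"
  have det: "gdet ?p \<noteq> 0" using assms by (auto simp: gdet_def)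
  have "Ltype 1 0 k l \<in> orbit (Ltype p z k l)"
  proof (rule orbit_basisI[OF det])
    fix i j m
    show "(\<Sum>x\<in>UNIV. \<Sum>y\<in>UNIV. gmat ?p x i * gmat ?p y j * Ltype 1 0 k l (x, y, m))
        = (\<Sum>n\<in>UNIV. gmat ?p m n * Ltype p z k l (i, j, n))"
      unfolding Ltype_def sum_idx by (cases i; cases j; cases m) (simp_all add: strc_def)
  qed
  then show "Ltype p z k l \<in> orbit (Ltype 1 0 k l)" by (rule orbit_sym)
  have "Rtype 1 0 k l \<in> orbit (Rtype p z k l)"
  proof (rule orbit_basisI[OF det])
    fix i j m
    show "(\<Sum>x\<in>UNIV. \<Sum>y\<in>UNIV. gmat ?p x i * gmat ?p y j * Rtype 1 0 k l (x, y, m))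
        = (\<Sum>n\<in>UNIV. gmat ?p m n * Rtype p z k l (i, j, n))"
      unfolding Rtype_def sum_idx by (cases i; cases j; cases m) (simp_all add: strc_def)
  qed
  then show "Rtype p z k l \<in> orbit (Rtype 1 0 k l)" by (rule orbit_sym)
qed

text \<open>The coefficients are those of the cubic polynomial in \<open>t\<close> that measures the linear
  independence of \<open>x\<close> and \<open>x x\<close> for \<open>x = e\<^sub>1 + t e\<^sub>2\<close>.\<close>

lemma not_generated_imp_wedge_zero:
  assumes "\<forall>c'\<in>orbit (strc p q u v u' v' w z l\<^sub>1 l\<^sub>2 r\<^sub>1 r\<^sub>2 s\<^sub>1 s\<^sub>2). c' (E1, E1, E2) = 0"
  shows "q = 0" "w = 0" "v' = p - v" "u' = z - u"
proof -
  let ?c = "strc p q u v u' v' w z l\<^sub>1 l\<^sub>2 r\<^sub>1 r\<^sub>2 s\<^sub>1 s\<^sub>2"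
  have wedge: "q + t * (v + v' - p) + t * t * (z - u - u') - t * t * t * w = 0" for t
  proof -
    \<comment> \<open>The inverse of this shear sends e_1 to x = e_1 + t e_2; the constant obtained
      is the e_2-coordinate of x x minus t times its e_1-coordinate.\<close>
    let ?p = "\<lambda>x. case x of P11 \<Rightarrow> 1 | P12 \<Rightarrow> 0 | P21 \<Rightarrow> - t | P22 \<Rightarrow> 1 | PF \<Rightarrow> 1"
    have "gdet ?p \<noteq> 0" by (simp add: gdet_def)
    then have "act (gmat ?p) (hmat ?p) ?c (E1, E1, E2) = 0"
      using assms mem_orbit_iff by blast
    then show ?thesis
      by (simp add: act_def sum_idx hmat_def gdet_def strc_def algebra_simps)
  qed
  have q: "q = 0" using wedge[of 0] by simp
  \<comment> \<open>Together with \<open>t = 0\<close>, three further values of \<open>t\<close>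
    determine all four coefficients of the cubic.\<close>
  have "(v + v' - p) + (z - u - u') - w = 0" "- (v + v' - p) + (z - u - u') + w = 0"
    "2 * (v + v' - p) + 4 * (z - u - u') - 8 * w = 0"
    using wedge[of 1] wedge[of "-1"] wedge[of 2] q by simp_all
  then have z: "z - u - u' = 0" and w: "w = 0" and v: "v + v' - p = 0" by algebra+
  from q show "q = 0" . from w show "w = 0" .
  from v show "v' = p - v" by (simp add: algebra_simps)
  from z show "u' = z - u" by (simp add: algebra_simps)
qed

lemma not_generated_cases:
  assumes "c \<in> AssocVar" "\<forall>c'\<in>orbit c. c' (E1, E1, E2) = 0"
  obtains (zero) s\<^sub>1 s\<^sub>2 where "c = strc 0 0 0 0 0 0 0 0 0 0 0 0 s\<^sub>1 s\<^sub>2"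
    | (left) p z k l where "p \<noteq> 0 \<or> z \<noteq> 0" "k \<in> {0, 1}" "l \<in> {0, 1}" "c = Ltype p z k l"
    | (right) p z k l where "p \<noteq> 0 \<or> z \<noteq> 0" "k \<in> {0, 1}" "l \<in> {0, 1}" "c = Rtype p z k l"
proof -
  obtain p q u v u' v' w z l\<^sub>1 l\<^sub>2 r\<^sub>1 r\<^sub>2 s\<^sub>1 s\<^sub>2
    where c: "c = strc p q u v u' v' w z l\<^sub>1 l\<^sub>2 r\<^sub>1 r\<^sub>2 s\<^sub>1 s\<^sub>2" using AssocVarE[OF assms(1)] by blast
  note wedge = not_generated_imp_wedge_zero[OF assms(2)[unfolded c]]
  note eqs = assms(1)[unfolded c strc_AssocVar_iff]
  have "u * v = w * q" "v' * u' = q * w" "p * v + q * z = u * q + v * v" "u * u + v * w = w * p + z * u"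
    using eqs by blast+
  then have "u * v = 0" "(p - v) * (z - u) = 0" "v * (p - v) = 0" "u * (z - u) = 0"
    unfolding wedge by auto
  \<comment> \<open>The first alternative is the product \<phi>(x) y, the second \<phi>(y)
    x.\<close>
  then have type: "u = 0 \<and> v = p \<or> u = z \<and> v = 0" by auto
  have lr: "p * l\<^sub>1 = l\<^sub>1 * l\<^sub>1" "p * r\<^sub>1 = r\<^sub>1 * r\<^sub>1" "z * l\<^sub>2 = l\<^sub>2 * l\<^sub>2" "z * r\<^sub>2 = r\<^sub>2 * r\<^sub>2"
    "p * l\<^sub>2 = l\<^sub>1 * l\<^sub>2 \<and> z * l\<^sub>1 = l\<^sub>1 * l\<^sub>2" "p * r\<^sub>2 = r\<^sub>1 * r\<^sub>2 \<and> z * r\<^sub>1 = r\<^sub>1 * r\<^sub>2"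
  proof -
    have f: "p * l\<^sub>1 + q * l\<^sub>2 = l\<^sub>1 * l\<^sub>1" "r\<^sub>1 * r\<^sub>1 = p * r\<^sub>1 + q * r\<^sub>2" "w * l\<^sub>1 + z * l\<^sub>2 = l\<^sub>2 * l\<^sub>2"
      "r\<^sub>2 * r\<^sub>2 = w * r\<^sub>1 + z * r\<^sub>2" "u * l\<^sub>1 + v * l\<^sub>2 = l\<^sub>2 * l\<^sub>1" "u' * l\<^sub>1 + v' * l\<^sub>2 = l\<^sub>1 * l\<^sub>2"
      "r\<^sub>1 * r\<^sub>2 = u * r\<^sub>1 + v * r\<^sub>2" "r\<^sub>2 * r\<^sub>1 = u' * r\<^sub>1 + v' * r\<^sub>2"
      using eqs by blast+
    show "p * l\<^sub>1 = l\<^sub>1 * l\<^sub>1" "p * r\<^sub>1 = r\<^sub>1 * r\<^sub>1" "z * l\<^sub>2 = l\<^sub>2 * l\<^sub>2" "z * r\<^sub>2 = r\<^sub>2 * r\<^sub>2"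
      using f(1-4) unfolding wedge by auto
    from type show "p * l\<^sub>2 = l\<^sub>1 * l\<^sub>2 \<and> z * l\<^sub>1 = l\<^sub>1 * l\<^sub>2" "p * r\<^sub>2 = r\<^sub>1 * r\<^sub>2 \<and> z * r\<^sub>1 = r\<^sub>1 * r\<^sub>2"
      using f(5-8) unfolding wedge by (simp_all only: mult.commute) (elim disjE conjE; simp)+
  qed
  show ?thesis
  proof (cases "p = 0 \<and> z = 0")
    case True
    then have "u = 0" "v = 0" "l\<^sub>1 = 0" "l\<^sub>2 = 0" "r\<^sub>1 = 0" "r\<^sub>2 = 0" using lr type by auto
    then have "c = strc 0 0 0 0 0 0 0 0 0 0 0 0 s\<^sub>1 s\<^sub>2" unfolding c wedge using True by simp
    then show ?thesis by (rule zero)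
  next
    case False
    have scale: "\<exists>k\<in>{0, 1}. x\<^sub>1 = k * p \<and> x\<^sub>2 = k * z"
      if "p * x\<^sub>1 = x\<^sub>1 * x\<^sub>1" "z * x\<^sub>2 = x\<^sub>2 * x\<^sub>2" "p * x\<^sub>2 = x\<^sub>1 * x\<^sub>2 \<and> z * x\<^sub>1 = x\<^sub>1 * x\<^sub>2" for x\<^sub>1 x\<^sub>2
    proof (cases "x\<^sub>1 = 0 \<and> x\<^sub>2 = 0")
      case nonzero: False
      then have "x\<^sub>1 = p \<and> x\<^sub>2 = z" using that False by auto
      then show ?thesis by auto
    qed auto
    obtain k where k: "k \<in> {0, 1}" "l\<^sub>1 = k * p" "l\<^sub>2 = k * z" using scale lr by meson
    obtain l where l: "l \<in> {0, 1}" "r\<^sub>1 = l * p" "r\<^sub>2 = l * z" using scale lr by meson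
    \<comment> \<open>For the product \<phi>(x) y and s = f_1 f_1 nonzero, x s = (x f_1) f_1 forces
      k = 1, and the right action equals the left one. Then s x = f_1 (f_1 x) reads \<phi>(s) x =
      \<phi>(x) s: an x in the kernel of \<phi> gives \<phi>(s) = 0, any other x gives s = 0. The
      other product is symmetric.\<close>
    have "s\<^sub>1 = 0 \<and> s\<^sub>2 = 0"
    proof (rule ccontr)
      assume s: "\<not> (s\<^sub>1 = 0 \<and> s\<^sub>2 = 0)"
      have s_eqs: "l\<^sub>1 * s\<^sub>1 = s\<^sub>1 * p + s\<^sub>2 * u" "l\<^sub>1 * s\<^sub>2 = s\<^sub>1 * q + s\<^sub>2 * v"
        "l\<^sub>2 * s\<^sub>1 = s\<^sub>1 * u' + s\<^sub>2 * w" "l\<^sub>2 * s\<^sub>2 = s\<^sub>1 * v' + s\<^sub>2 * z"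
        "s\<^sub>1 * p + s\<^sub>2 * u' = r\<^sub>1 * s\<^sub>1" "s\<^sub>1 * q + s\<^sub>2 * v' = r\<^sub>1 * s\<^sub>2"
        "s\<^sub>1 * u + s\<^sub>2 * w = r\<^sub>2 * s\<^sub>1" "s\<^sub>1 * v + s\<^sub>2 * z = r\<^sub>2 * s\<^sub>2"
        using eqs by blast+
      have "r\<^sub>1 = l\<^sub>1" "r\<^sub>2 = l\<^sub>2" using eqs s by blast+
      then show False
        using s_eqs False s k(1) type unfolding wedge k(2,3) by auto
    qed
    then have "c = Ltype p z k l \<or> c = Rtype p z k l"
      using type unfolding c wedge Ltype_def Rtype_def k(2,3) l(2,3) by auto
    moreover have "p \<noteq> 0 \<or> z \<noteq> 0" using False by simp
    ultimately show ?thesis using left right k(1) l(1) by metis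
  qed
qed

text \<open>An algebra spanned by one element and its powers is commutative. Used in contraposition:
  a polynomial inequation excludes the generated case.\<close>

lemma generated_imp_even_commutes:
  assumes "c \<in> AssocVar" "c' \<in> orbit c" "c' (E1, E1, E2) \<noteq> 0"
  shows "c (E1, E2, E2) = c (E2, E1, E2)"
proof -
  have "c' \<in> AssocVar" using assms orbit_subset_AssocVar by blast
  then obtain p q a b k l g where "c' = fam p q a b k l g"
    using fam_exists[of c'] assms(3) by metis
  then have "even_commutes c'" unfolding fam_def by (simp add: even_commutes_strc)
  then have "even_commutes c"
    using invariants_orbit[OF assms(2)] unfolding invariants_def by simp
  moreover obtain p q u v u' v' w z l\<^sub>1 l\<^sub>2 r\<^sub>1 r\<^sub>2 s\<^sub>1 s\<^sub>2
    where "c = strc p q u v u' v' w z l\<^sub>1 l\<^sub>2 r\<^sub>1 r\<^sub>2 s\<^sub>1 s\<^sub>2" using AssocVarE[OF assms(1)] by blast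
  ultimately have "v = v'" "c = strc p q u v u' v' w z l\<^sub>1 l\<^sub>2 r\<^sub>1 r\<^sub>2 s\<^sub>1 s\<^sub>2"
    by (simp_all add: even_commutes_strc)
  then show ?thesis by (simp add: strc_def)
qed

section \<open>Open orbits\<close>

lemma openin_orbit_Ltype:
  assumes "k \<in> {0, 1}" "l \<in> {0, 1}"
  shows "openin XT (orbit (Ltype 1 0 k l))"
proof (rule openin_XT_orbitI[OF _ orbit_refl])
  \<comment> \<open>The first factor excludes generated even parts, the second the type
    \<open>Rtype\<close>. On \<open>Ltype p z k' l'\<close> the others are
    \<open>(k' - (1 - k)) * p\<close> and \<open>(l' - (1 - l)) * p\<close>, which exclude the wrong
    value of \<open>k'\<close> and \<open>l'\<close> in {0, 1}.\<close>
  let ?f = "\<lambda>c :: struc. (c (E1, E2, E2) - c (E2, E1, E2)) * c (E1, E2, E2)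
    * (c (E1, F1, F1) - (1 - k) * c (E1, E2, E2)) * (c (F1, E1, F1) - (1 - l) * c (E1, E2, E2))"
  show "?f \<in> polyfun" by (intro polyfun_intros)
  show "?f (Ltype 1 0 k l) \<noteq> 0" using assms by (auto simp: Ltype_def strc_def)
  show "Ltype 1 0 k l \<in> AssocVar" using assms by (auto simp: Ltype_def strc_AssocVar_iff)
  fix c assume c: "c \<in> AssocVar" "?f c \<noteq> 0"
  then have "\<forall>c'\<in>orbit c. c' (E1, E1, E2) = 0"
    using generated_imp_even_commutes[OF c(1)] by auto
  from c(1) this show "c \<in> orbit (Ltype 1 0 k l)"
  proof (cases rule: not_generated_cases)
    case (left p z k' l')
    then have "k' = k" "l' = l" using c(2) assms by (auto simp: Ltype_def strc_def)
    then show ?thesis using left type_orbit by simp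
  qed (use c(2) in \<open>simp_all add: Rtype_def strc_def\<close>)
qed

lemma openin_orbit_Rtype:
  assumes "k \<in> {0, 1}" "l \<in> {0, 1}"
  shows "openin XT (orbit (Rtype 1 0 k l))"
proof (rule openin_XT_orbitI[OF _ orbit_refl])
  let ?f = "\<lambda>c :: struc. (c (E1, E2, E2) - c (E2, E1, E2)) * c (E2, E1, E2)
    * (c (E1, F1, F1) - (1 - k) * c (E2, E1, E2)) * (c (F1, E1, F1) - (1 - l) * c (E2, E1, E2))"
  show "?f \<in> polyfun" by (intro polyfun_intros)
  show "?f (Rtype 1 0 k l) \<noteq> 0" using assms by (auto simp: Rtype_def strc_def)
  show "Rtype 1 0 k l \<in> AssocVar" using assms by (auto simp: Rtype_def strc_AssocVar_iff)
  fix c assume c: "c \<in> AssocVar" "?f c \<noteq> 0"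
  then have "\<forall>c'\<in>orbit c. c' (E1, E1, E2) = 0"
    using generated_imp_even_commutes[OF c(1)] by auto
  from c(1) this show "c \<in> orbit (Rtype 1 0 k l)"
  proof (cases rule: not_generated_cases)
    case (right p z k' l')
    then have "k' = k" "l' = l" using c(2) assms by (auto simp: Rtype_def strc_def)
    then show ?thesis using right type_orbit by simp
  qed (use c(2) in \<open>simp_all add: Ltype_def strc_def\<close>)
qed

text \<open>With \<open>A\<close> and \<open>B\<close> as for \<open>fam\<close>, the two factors after \<open>q\<close> are
  \<open>q\<^sup>2 (a - b)\<^sup>2\<close> and \<open>A B\<close>.\<close>

definition split_poly :: "struc \<Rightarrow> complex" where
  "split_poly c = c (E1, E1, E2) * ((c (E1, E2, E2) - c (E1, E1, E1))\<^sup>2 + 4 * c (E1, E2, E1) * c (E1, E1, E2))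
     * (c (E1, E1, E1) * c (E1, E2, E2) - c (E1, E1, E2) * c (E1, E2, E1))"

text \<open>The characteristic polynomial of left multiplication by e_1 on the even part. On
  \<open>fam\<close> its roots are A and B, so nonvanishing at the scalar of e_1 on f_1 forces the
  zero character.\<close>

definition e1_charpoly :: "struc \<Rightarrow> complex \<Rightarrow> complex" where
  "e1_charpoly c x = x\<^sup>2 - (c (E1, E1, E1) + c (E1, E2, E2)) * x
     + (c (E1, E1, E1) * c (E1, E2, E2) - c (E1, E1, E2) * c (E1, E2, E1))"

lemma polyfun_split_poly: "(\<lambda>c. split_poly c) \<in> polyfun"
  unfolding split_poly_def by (intro polyfun_intros)

lemma polyfun_e1_charpoly: "f \<in> polyfun \<Longrightarrow> (\<lambda>c. e1_charpoly c (f c)) \<in> polyfun"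
  unfolding e1_charpoly_def by (intro polyfun_intros)

lemma split_poly_fam:
  "split_poly (fam p q a b k l g) = q ^ 3 * (a - b)\<^sup>2 * (p + q * a) * (p + q * b)"
  unfolding split_poly_def fam_def
  by (simp add: strc_def power2_eq_square power3_eq_cube algebra_simps)

lemma e1_charpoly_fam:
  "e1_charpoly (fam p q a b k l g) x = (x - (p + q * a)) * (x - (p + q * b))"
  unfolding e1_charpoly_def fam_def
  by (simp add: strc_def power2_eq_square algebra_simps)

lemma fam_coeffs:
  "fam p q a b k l g (E1, F1, F1) = fam_val p q a b k" "fam p q a b k l g (F1, E1, F1) = fam_val p q a b l"
  "fam p q a b k l g (F1, F1, E2) = g" "fam p q a b k l g (F1, F1, E1) = - g * b"
  "fam p q a b k l g (E1, E1, E1) = p" "fam p q a b k l g (E1, E1, E2) = q"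
  unfolding fam_def strc_def by simp_all

lemma fam_exists_normal:
  assumes "c \<in> AssocVar" "c (E1, E1, E2) \<noteq> 0"
  obtains p q a b where "c = fam p q a b 0 0 0" | p q a b where "c = fam p q a b 0 1 0"
    | p q a b where "c = fam p q a b 1 0 0" | p q a b where "c = fam p q a b 2 1 0"
    | p q a b g where "c = fam p q a b 1 1 g"
proof -
  obtain p q a b k l g where c: "c = fam p q a b k l g" "k \<le> 2" "l \<le> 2" "g = 0 \<or> k = 1 \<and> l = 1"
    using fam_exists[OF assms] by metis
  have "k = 0 \<or> k = 1 \<or> k = 2" "l = 0 \<or> l = 1 \<or> l = 2" using c(2,3) by auto
  with c(4) consider "k = 1 \<and> l = 1" | "g = 0 \<and> k = 0 \<and> l = 0" | "g = 0 \<and> k = 0 \<and> l = 1"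
    | "g = 0 \<and> k = 0 \<and> l = 2" | "g = 0 \<and> k = 1 \<and> l = 0" | "g = 0 \<and> k = 1 \<and> l = 2"
    | "g = 0 \<and> k = 2 \<and> l = 0" | "g = 0 \<and> k = 2 \<and> l = 1" | "g = 0 \<and> k = 2 \<and> l = 2"
    by auto
  then show thesis
  proof cases
    case 1
    then show ?thesis using c(1) that(5)[of p q a b g] by simp
  next
    case 2
    then show ?thesis using c(1) that(1)[of p q a b] by simp
  next
    case 3
    then show ?thesis using c(1) that(2)[of p q a b] by simp
  next
    case 4
    then show ?thesis using c(1) that(2)[of p q b a] by (simp add: fam_swap(1))
  next
    case 5
    then show ?thesis using c(1) that(3)[of p q a b] by simp
  next
    case 6
    then show ?thesis using c(1) that(4)[of p q b a] fam_swap(3)[of p q a b] by simp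
  next
    case 7
    then show ?thesis using c(1) that(3)[of p q b a] fam_swap(2)[of p q a b] by simp
  next
    case 8
    then show ?thesis using c(1) that(4)[of p q a b] by simp
  next
    case 9
    then show ?thesis using c(1) that(5)[of p q b a 0] fam_swap(4)[of p q a b] by simp
  qed
qed

text \<open>The sample point has p = 0, q = 1, A = a = 1 and B = b = 2. \<open>split_poly\<close>
  ensures generic roots, \<open>h\<close> selects the pair of characters, and \<open>G\<close> is
  the condition on \<open>g\<close> that belongs to the orbit.\<close>

lemma openin_orbit_fam:
  assumes "h \<in> polyfun" "r \<in> Rlist" "fam 0 1 1 2 k l g\<^sub>0 \<in> orbit r"
    "split_poly (fam 0 1 1 2 k l g\<^sub>0) * h (fam 0 1 1 2 k l g\<^sub>0) \<noteq> 0"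
    and "\<And>c. c \<in> AssocVar \<Longrightarrow> c (E1, E1, E2) \<noteq> 0 \<Longrightarrow> h c \<noteq> 0 \<Longrightarrow> \<exists>p q a b g. c = fam p q a b k l g \<and> G g"
    and "\<And>p q a b g. p + q * a \<noteq> 0 \<Longrightarrow> p + q * b \<noteq> 0 \<Longrightarrow> a \<noteq> b \<Longrightarrow> G g \<Longrightarrow> fam p q a b k l g \<in> orbit r"
  shows "openin XT (orbit r)"
proof (rule openin_XT_orbitI[OF _ assms(3)])
  show "(\<lambda>c. split_poly c * h c) \<in> polyfun"
    by (intro pmult polyfun_split_poly assms(1))
  show "split_poly (fam 0 1 1 2 k l g\<^sub>0) * h (fam 0 1 1 2 k l g\<^sub>0) \<noteq> 0" by (rule assms(4))
  show "r \<in> AssocVar" using assms(2) by (rule Rlist_AssocVar)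
  fix c assume c: "c \<in> AssocVar" "split_poly c * h c \<noteq> 0"
  then have "c (E1, E1, E2) \<noteq> 0" "h c \<noteq> 0" by (auto simp: split_poly_def)
  then obtain p q a b g where fam: "c = fam p q a b k l g" "G g"
    using assms(5)[OF c(1)] by metis
  moreover have "split_poly c \<noteq> 0" using c(2) by simp
  ultimately show "c \<in> orbit r"
    using assms(6)[of p q a b g] by (auto simp: split_poly_fam)
qed

lemma openin_orbit_R:
  "openin XT (orbit R01)" "openin XT (orbit R03)" "openin XT (orbit R04)" "openin XT (orbit R05)"
  "openin XT (orbit R07)"
proof -
  have R: "R01 \<in> Rlist" "R03 \<in> Rlist" "R04 \<in> Rlist" "R05 \<in> Rlist" "R07 \<in> Rlist"
    by (simp_all add: Rlist_def)
  note simps = e1_charpoly_fam fam_coeffs fam_val_def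
  show "openin XT (orbit R01)"
  proof (rule openin_orbit_fam[OF _ R(1)])
    let ?h = "\<lambda>c :: struc. e1_charpoly c (c (E1, F1, F1)) * e1_charpoly c (c (F1, E1, F1))"
    show "?h \<in> polyfun" by (intro polyfun_intros polyfun_e1_charpoly)
    show "fam 0 1 1 2 0 0 0 \<in> orbit R01" by (rule fam_generic) simp_all
    show "split_poly (fam 0 1 1 2 0 0 0) * ?h (fam 0 1 1 2 0 0 0) \<noteq> 0"
      by (simp add: split_poly_fam simps)
    show "\<exists>p q a b g. c = fam p q a b 0 0 g \<and> g = 0"
      if "c \<in> AssocVar" "c (E1, E1, E2) \<noteq> 0" "?h c \<noteq> 0" for c
      using that by (cases rule: fam_exists_normal[OF that(1,2)]) (auto simp: simps; blast)+
  qed (use fam_generic in simp_all)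
  show "openin XT (orbit R03)"
  proof (rule openin_orbit_fam[OF _ R(2)])
    let ?h = "\<lambda>c :: struc. c (F1, F1, E2)"
    show "?h \<in> polyfun" by (intro polyfun_intros polyfun_e1_charpoly)
    show "fam 0 1 1 2 1 1 1 \<in> orbit R03" by (rule fam_generic) simp_all
    show "split_poly (fam 0 1 1 2 1 1 1) * ?h (fam 0 1 1 2 1 1 1) \<noteq> 0"
      by (simp add: split_poly_fam simps)
    show "\<exists>p q a b g. c = fam p q a b 1 1 g \<and> g \<noteq> 0"
      if "c \<in> AssocVar" "c (E1, E1, E2) \<noteq> 0" "?h c \<noteq> 0" for c
      using that by (cases rule: fam_exists_normal[OF that(1,2)]) (auto simp: simps; blast)+
  qed (use fam_generic in simp_all)
  show "openin XT (orbit R04)"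
  proof (rule openin_orbit_fam[OF _ R(3)])
    let ?h = "\<lambda>c :: struc. e1_charpoly c (c (E1, F1, F1)) * c (F1, E1, F1)"
    show "?h \<in> polyfun" by (intro polyfun_intros polyfun_e1_charpoly)
    show "fam 0 1 1 2 0 1 0 \<in> orbit R04" by (rule fam_generic) simp_all
    show "split_poly (fam 0 1 1 2 0 1 0) * ?h (fam 0 1 1 2 0 1 0) \<noteq> 0"
      by (simp add: split_poly_fam simps)
    show "\<exists>p q a b g. c = fam p q a b 0 1 g \<and> g = 0"
      if "c \<in> AssocVar" "c (E1, E1, E2) \<noteq> 0" "?h c \<noteq> 0" for c
      using that by (cases rule: fam_exists_normal[OF that(1,2)]) (auto simp: simps; blast)+
  qed (use fam_generic in simp_all)
  show "openin XT (orbit R05)"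
  proof (rule openin_orbit_fam[OF _ R(4)])
    let ?h = "\<lambda>c :: struc. c (E1, F1, F1) * e1_charpoly c (c (F1, E1, F1))"
    show "?h \<in> polyfun" by (intro polyfun_intros polyfun_e1_charpoly)
    show "fam 0 1 1 2 1 0 0 \<in> orbit R05" by (rule fam_generic) simp_all
    show "split_poly (fam 0 1 1 2 1 0 0) * ?h (fam 0 1 1 2 1 0 0) \<noteq> 0"
      by (simp add: split_poly_fam simps)
    show "\<exists>p q a b g. c = fam p q a b 1 0 g \<and> g = 0"
      if "c \<in> AssocVar" "c (E1, E1, E2) \<noteq> 0" "?h c \<noteq> 0" for c
      using that by (cases rule: fam_exists_normal[OF that(1,2)]) (auto simp: simps; blast)+
  qed (use fam_generic in simp_all)
  show "openin XT (orbit R07)"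
  proof (rule openin_orbit_fam[OF _ R(5)])
    let ?h = "\<lambda>c :: struc. c (E1, F1, F1) * c (F1, E1, F1) * (c (E1, F1, F1) - c (F1, E1, F1))"
    show "?h \<in> polyfun" by (intro polyfun_intros polyfun_e1_charpoly)
    show "fam 0 1 1 2 2 1 0 \<in> orbit R07" by (rule fam_generic) simp_all
    show "split_poly (fam 0 1 1 2 2 1 0) * ?h (fam 0 1 1 2 2 1 0) \<noteq> 0"
      by (simp add: split_poly_fam simps)
    show "\<exists>p q a b g. c = fam p q a b 2 1 g \<and> g = 0"
      if "c \<in> AssocVar" "c (E1, E1, E2) \<noteq> 0" "?h c \<noteq> 0" for c
      using that by (cases rule: fam_exists_normal[OF that(1,2)]) (auto simp: simps; blast)+
  qed (use fam_generic in simp_all)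
qed

lemma openin_orbit_Rlist: "r \<in> Rlist \<Longrightarrow> openin XT (orbit r)"
  unfolding Rlist_def R_eq_type using openin_orbit_R openin_orbit_Ltype openin_orbit_Rtype by auto

section \<open>Orbit closures cover the variety\<close>

text \<open>With p = q = a = 0 all products in \<open>fam\<close> vanish except f_1 f_1 = -g b e_1 +
  g e_2. This reaches every square with nonzero e_2-coordinate, and density gives the rest.\<close>

lemma zero_product_in_closure:
  "strc 0 0 0 0 0 0 0 0 0 0 0 0 s\<^sub>1 s\<^sub>2 \<in> zariski closure_of (orbit R03)"
proof -
  let ?\<phi> = "\<lambda>x :: prm \<Rightarrow> complex. strc 0 0 0 0 0 0 0 0 0 0 0 0 (x P11) (x P12)"
  have "zariski_closed (zariski closure_of (orbit R03))"
    by (simp flip: closedin_zariski)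
  moreover have "(\<lambda>x. ?\<phi> x t) \<in> polyfun" for t
    by (intro polyfun_strc polyfun_intros)
  moreover have "(\<lambda>x :: prm \<Rightarrow> complex. x P12) \<in> polyfun" "(\<lambda>_. 1 :: complex) P12 \<noteq> 0"
    by (simp_all add: pvar)
  moreover have "?\<phi> x \<in> zariski closure_of (orbit R03)" if "x P12 \<noteq> 0" for x
  proof -
    have "?\<phi> x = fam 0 0 0 (- x P11 / x P12) 1 1 (x P12)"
      using that by (simp add: fam_def fam_val_def)
    then show ?thesis by (simp only: fam_in_closure(5))
  qed
  ultimately have "?\<phi> x \<in> zariski closure_of (orbit R03)" for x
    by (rule zariski_closed_contains_image[where \<phi> = ?\<phi> and D = "\<lambda>x. x P12" and p\<^sub>0 = "\<lambda>_. 1"])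
  from this[of "\<lambda>x. if x = P11 then s\<^sub>1 else s\<^sub>2"] show ?thesis by simp
qed

lemma in_orbit_closure:
  assumes "c \<in> AssocVar"
  shows "\<exists>r\<in>Rlist. c \<in> zariski closure_of (orbit r)"
proof (cases "\<forall>c'\<in>orbit c. c' (E1, E1, E2) = 0")
  case True
  have closure: "c \<in> zariski closure_of (orbit r)" if "c \<in> orbit r" for r
    using that closure_of_subset[of "orbit r" zariski] by auto
  have mem: "Ltype 1 0 k l \<in> Rlist" "Rtype 1 0 k l \<in> Rlist" if "k \<in> {0, 1}" "l \<in> {0, 1}" for k l
    using that unfolding Rlist_def R_eq_type by auto
  from assms True show ?thesis
  proof (cases rule: not_generated_cases)
    case (zero s\<^sub>1 s\<^sub>2)
    then show ?thesis using zero_product_in_closure by (auto simp: Rlist_def)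
  next
    case (left p z k l)
    then show ?thesis using mem(1)[of k l] closure type_orbit(1) by blast
  next
    case (right p z k l)
    then show ?thesis using mem(2)[of k l] closure type_orbit(2) by blast
  qed
next
  case False
  then obtain c' where c': "c' \<in> orbit c" "c' (E1, E1, E2) \<noteq> 0" by blast
  have "c' \<in> AssocVar" using c'(1) orbit_subset_AssocVar[OF assms] by blast
  have "\<exists>r\<in>Rlist. c' \<in> zariski closure_of (orbit r)"
    by (cases rule: fam_exists_normal[OF \<open>c' \<in> AssocVar\<close> c'(2)])
      (simp_all add: Rlist_def fam_in_closure del: One_nat_def)
  then show ?thesis
    using orbit_closure_invariant[OF orbit_sym[OF c'(1)]] by blast
qed

section \<open>Dimension\<close>

lemma irreducible_in_subtopology_closure_of:
  assumes "irreducible_in T S" "S \<subseteq> Y"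
  shows "irreducible_in (subtopology T Y) (subtopology T Y closure_of S)"
  using assms by (intro irreducible_in_closure_of) (simp add: irreducible_in_subtopology)

lemma chain_len_R03: "chain_len (subtopology XT (XT closure_of (orbit R03))) 5"
proof -
  define Y where "Y = XT closure_of (orbit R03)"
  define \<phi> where "\<phi> x = fam (x P11) (x P12) (x P21) (x P22) 1 1 (x PF)" for x
  \<comment> \<open>The slopes \<open>a\<close> and \<open>b\<close> come last because they are
    detected by the functions \<open>q * a\<close> and \<open>- g * b\<close>, which need
    \<open>q\<close> and \<open>g\<close> to be free already.\<close>
  define rank :: "prm \<Rightarrow> nat" where
    "rank v = (case v of PF \<Rightarrow> 0 | P11 \<Rightarrow> 1 | P12 \<Rightarrow> 2 | P21 \<Rightarrow> 3 | P22 \<Rightarrow> 4)" for v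
  define S where "S i = \<phi> ` {x. \<forall>v. i \<le> rank v \<longrightarrow> x v = 0}" for i
  define T where "T = subtopology XT Y"
  have R03: "R03 \<in> AssocVar" by (rule Rlist_AssocVar) (simp add: Rlist_def)
  have "Y \<subseteq> AssocVar" unfolding Y_def by (simp add: XT_closure_of_orbit[OF R03])
  then have T: "T = subtopology zariski Y"
    unfolding T_def by (rule subtopology_XT)
  have "\<phi> x \<in> Y" for x
    unfolding Y_def \<phi>_def XT_closure_of_orbit[OF R03] using fam_AssocVar fam_in_closure(5) by blast
  then have SY: "S i \<subseteq> Y" for i unfolding S_def by blast
  have irred: "irreducible_in zariski (S i)" for i
  proof -
    \<comment> \<open>Truncating the parameters inside the map presents \<open>S i\<close> as the
      image of a whole affine space.\<close>
    define \<psi> where "\<psi> x = \<phi> (\<lambda>v. if rank v < i then x v else 0)" for x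
    have poly: "(\<lambda>x. if rank v < i then x v else 0) \<in> polyfun" for v
      by (cases "rank v < i") (simp_all add: pconst pvar)
    have "(\<lambda>x. \<psi> x t) \<in> polyfun" for t
      unfolding \<psi>_def \<phi>_def by (intro polyfun_fam poly)
    then have "irreducible_in zariski (\<psi> ` {x. (1 :: complex) \<noteq> 0})"
      by (intro irreducible_rational_image polynomial_rational_map) simp_all
    moreover have "\<psi> ` {x. (1 :: complex) \<noteq> 0} = S i"
    proof (intro equalityI subsetI)
      fix y assume "y \<in> S i"
      then obtain x where x: "y = \<phi> x" "\<And>v. i \<le> rank v \<Longrightarrow> x v = 0" unfolding S_def by blast
      have "(\<lambda>v. if rank v < i then x v else 0) = x"
        using x(2) by (auto simp: fun_eq_iff not_less)
      then have "y = \<psi> x" unfolding \<psi>_def x(1) by simp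
      then show "y \<in> \<psi> ` {x. (1 :: complex) \<noteq> 0}" by simp
    qed (auto simp: S_def \<psi>_def)
    ultimately show ?thesis by simp
  qed
  have strict: "T closure_of S i \<subset> T closure_of S (Suc i)"
    if f: "f \<in> polyfun" "\<And>x. (\<And>v. i \<le> rank v \<Longrightarrow> x v = 0) \<Longrightarrow> f (\<phi> x) = 0"
      and x: "\<And>v. Suc i \<le> rank v \<Longrightarrow> x v = 0" "f (\<phi> x) \<noteq> 0" for i f x
  proof -
    have "S i \<subseteq> S (Suc i)" unfolding S_def by auto
    then have "T closure_of S i \<subseteq> T closure_of S (Suc i)" by (rule closure_of_mono)
    moreover have "closedin T (Y \<inter> {y. f y = 0})"
      unfolding T using f(1) zariski_closed_zeros by (auto simp: closedin_subtopology closedin_zariski)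
    then have "T closure_of S i \<subseteq> Y \<inter> {y. f y = 0}"
      using SY f(2) by (intro closure_of_minimal) (auto simp: S_def)
    then have "\<phi> x \<notin> T closure_of S i" using x(2) by auto
    moreover have "S (Suc i) \<subseteq> T closure_of S (Suc i)"
      using SY[of "Suc i"] by (intro closure_of_subset) (simp add: T)
    then have "\<phi> x \<in> T closure_of S (Suc i)" using x(1) unfolding S_def by auto
    ultimately show ?thesis by blast
  qed
  note simps = \<phi>_def fam_coeffs fam_val_def rank_def
  have "T closure_of S 0 \<subset> T closure_of S (Suc 0)"
    by (rule strict[where f = "\<lambda>c. c (F1, F1, E2)" and x = "\<lambda>v. if v = PF then 1 else 0"])
      (auto simp: simps pvar)
  moreover have "T closure_of S 1 \<subset> T closure_of S (Suc 1)"
    by (rule strict[where f = "\<lambda>c. c (E1, E1, E1)" and x = "\<lambda>v. if v = P11 then 1 else 0"])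
      (auto simp: simps pvar)
  moreover have "T closure_of S 2 \<subset> T closure_of S (Suc 2)"
    by (rule strict[where f = "\<lambda>c. c (E1, E1, E2)" and x = "\<lambda>v. if v = P12 then 1 else 0"])
      (auto simp: simps pvar)
  \<comment> \<open>The difference is \<open>q * a\<close>, which is zero as long as
    \<open>a\<close> is.\<close>
  moreover have "T closure_of S 3 \<subset> T closure_of S (Suc 3)"
    by (rule strict[where f = "\<lambda>c. c (E1, F1, F1) - c (E1, E1, E1)"
          and x = "\<lambda>v. if v = P12 \<or> v = P21 then 1 else 0"])
      (auto simp: simps intro!: polyfun_intros)
  moreover have "T closure_of S 4 \<subset> T closure_of S (Suc 4)"
    by (rule strict[where f = "\<lambda>c. c (F1, F1, E1)" and x = "\<lambda>v. if v = P22 \<or> v = PF then 1 else 0"])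
      (auto simp: simps pvar)
  moreover have "i = 0 \<or> i = 1 \<or> i = 2 \<or> i = 3 \<or> i = 4" if "i < 5" for i :: nat
    using that by auto
  ultimately have "T closure_of S i \<subset> T closure_of S (Suc i)" if "i < 5" for i
    using that by blast
  moreover have "irreducible_in T (T closure_of S i)" for i
    unfolding T using irred SY by (rule irreducible_in_subtopology_closure_of)
  ultimately show ?thesis
    unfolding chain_len_def T_def Y_def by (intro exI[of _ "\<lambda>i. T closure_of S i"]) (simp add: T_def Y_def)
qed

theorem mainTheorem10:
  shows "variety_dim XT = 5
    \<and> {C. irr_component XT C} = (\<lambda>c. XT closure_of (orbit c)) ` Rlist
    \<and> card {C. irr_component XT C} = 13
    \<and> {orbit c | c. rigid c} = orbit ` Rlist
    \<and> card {orbit c | c. rigid c} = 13"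
proof -
  have finite: "finite (orbit ` Rlist)" by (simp add: Rlist_def)
  have disjoint: "pairwise disjnt (orbit ` Rlist)"
    unfolding pairwise_def disjnt_def using orbit_eqI by blast
  have cover: "topspace XT \<subseteq> (\<Union>U\<in>orbit ` Rlist. XT closure_of U)"
    using in_orbit_closure by (auto simp: XT_closure_of_orbit[OF Rlist_AssocVar])
  have irreducible: "\<And>U. U \<in> orbit ` Rlist \<Longrightarrow> irreducible_in XT U"
    and open_orbits: "\<And>U. U \<in> orbit ` Rlist \<Longrightarrow> openin XT U"
    using irreducible_orbit Rlist_AssocVar openin_orbit_Rlist by auto
  note comps = irr_components_eq[OF finite irreducible open_orbits disjoint cover]
  have components: "{C. irr_component XT C} = (\<lambda>c. XT closure_of (orbit c)) ` Rlist"
    using comps(1) by (simp add: image_image)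
  have card_orbits: "card (orbit ` Rlist) = 13"
    using card_image[OF inj_on_orbit] card_Rlist by simp
  have card_components: "card {C. irr_component XT C} = 13"
    by (rule trans[OF arg_cong[where f = card, OF comps(1)] trans[OF card_image[OF comps(2)] card_orbits]])
  have rigid_orbits: "{orbit c | c. rigid c} = orbit ` Rlist"
  proof (intro equalityI subsetI)
    fix U assume "U \<in> {orbit c | c. rigid c}"
    then obtain c where c: "U = orbit c" "c \<in> AssocVar" "openin XT (orbit c)"
      unfolding rigid_def by auto
    obtain r where r: "r \<in> Rlist" "c \<in> zariski closure_of (orbit r)"
      using in_orbit_closure[OF c(2)] by auto
    then have "c \<in> XT closure_of (orbit r)"
      using c(2) by (simp add: XT_closure_of_orbit[OF Rlist_AssocVar])
    \<comment> \<open>An open orbit that meets the closure of another orbit meets that orbit itself,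
      hence equals it.\<close>
    then have "orbit c \<inter> orbit r \<noteq> {}"
      using openin_Int_closure_of_eq_empty[OF c(3), of "orbit r"] orbit_refl[of c] by blast
    then have "orbit c = orbit r" using orbit_eqI by blast
    then show "U \<in> orbit ` Rlist" using c(1) r(1) by simp
  next
    fix U assume "U \<in> orbit ` Rlist"
    then show "U \<in> {orbit c | c. rigid c}"
      unfolding rigid_def using Rlist_AssocVar openin_orbit_Rlist by auto
  qed
  have "variety_dim XT \<le> 5"
    unfolding variety_dim_def
  proof (rule Sup_least)
    fix d assume "d \<in> {krull_dim (subtopology XT C) | C. irr_component XT C}"
    then obtain C where "d = krull_dim (subtopology XT C)" "C \<in> {C. irr_component XT C}" by auto
    then show "d \<le> 5"
      unfolding components using krull_dim_orbit_closure_le[OF Rlist_AssocVar] by auto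
  qed
  moreover have "5 \<le> variety_dim XT"
  proof -
    let ?C = "XT closure_of (orbit R03)"
    have "?C \<in> {C. irr_component XT C}"
      unfolding components by (simp add: Rlist_def)
    then have "krull_dim (subtopology XT ?C) \<le> variety_dim XT"
      unfolding variety_dim_def by (intro Sup_upper) auto
    moreover have "enat 5 \<le> krull_dim (subtopology XT ?C)"
      unfolding krull_dim_def using chain_len_R03 by (intro Sup_upper) auto
    ultimately show ?thesis by (simp add: numeral_eq_enat)
  qed
  ultimately have "variety_dim XT = 5" by (rule antisym)
  then show ?thesis
    using components card_components rigid_orbits card_orbits by simp
qed

end
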